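(* Let $\mathbb{K}$ be a field and let $\mathcal{H}$ be a subset of $\{C_k : k\geq 3\}\cup\{K_2\}$ with $K_2\in\mathcal{H}$. Then for every graph $G$ we have $$\operatorname{reg}(S/I(G))\leq \operatorname{min-match}_{\mathcal{H}}(G).$$ In particular, $\operatorname{reg}(S/I(G))\leq \operatorname{min-match}_{\{K_2,C_5\}}(G)$ for every graph $G$.
   Context: All graphs are finite and simple. For a graph $G$ with vertex set $\{v_1,\dots,v_n\}$, $S=\mathbb{K}[x_1,\dots,x_n]$ is the polynomial ring over $\mathbb{K}$ with one variable per vertex, and $I(G)=(x_ix_j : v_iv_j\in E(G))\subseteq S$ is the edge ideal. For a finitely generated graded $S$-module $M$ with graded Betti numbers $\beta_{i,j}(M)$, the Castelnuovo--Mumford regularity is $\operatorname{reg}(M)=\max\{j-i : \beta_{i,j}(M)\neq 0\}$. $K_2$ is the complete graph on two vertices and $C_k$ the cycle on $k$ vertices. A matching of $G$ is a set of pairwise disjoint edges; $\operatorname{match}(G)$ is the largest cardinality of a matching of $G$. Let $\mathcal{H}$ be a collection of connected graphs with $K_2\in\mathcal{H}$. For a graph $G$ with at least one edge, an $\mathcal{H}$-subgraph of $G$ is a (nonempty, not necessarily induced) subgraph of $G$ each of whose connected components belongs to $\mathcal{H}$ (up to isomorphism). An $\mathcal{H}$-subgraph $H$ of $G$ is called maximal if $G\setminus V(H)$ (the graph obtained from $G$ by deleting the vertices of $H$) has no $\mathcal{H}$-subgraph. The minimum $\mathcal{H}$-matching number is $$\operatorname{min-match}_{\mathcal{H}}(G)=\min\{\operatorname{match}(H)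 : H \text{ is a maximal } \mathcal{H}\text{-subgraph of } G\},$$ and $\operatorname{min-match}_{\mathcal{H}}(G)=0$ if $G$ has no edge. *)

theory Defs
  imports "HOL-Algebra.QuotRing" "HOL-Algebra.Module" "HOL-Library.Poly_Mapping"
begin

section \<open>Finite simple graphs\<close>

record 'v graph =
  verts :: "'v set"
  edges :: "'v set set"

definition simple_graph :: "'v graph \<Rightarrow> bool" where
  "simple_graph G \<longleftrightarrow> finite (verts G) \<and> (\<forall>e\<in>edges G. e \<subseteq> verts G \<and> card e = 2)"

definition complete_graph :: "nat \<Rightarrow> nat graph" where
  "complete_graph n = \<lparr>verts = {..<n}, edges = {e. e \<subseteq> {..<n} \<and> card e = 2}\<rparr>"

text \<open>This is the cycle only for \<open>k \<ge> 3\<close>.\<close>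
definition cycle_graph :: "nat \<Rightarrow> nat graph" where
  "cycle_graph k = \<lparr>verts = {..<k}, edges = {{i, Suc i mod k} |i. i < k}\<rparr>"

definition graph_iso :: "'v graph \<Rightarrow> 'w graph \<Rightarrow> bool" where
  "graph_iso G H \<longleftrightarrow>
     (\<exists>f. bij_betw f (verts G) (verts H) \<and> (\<lambda>e. f ` e) ` edges G = edges H)"

definition induced_subgraph :: "'v graph \<Rightarrow> 'v set \<Rightarrow> 'v graph" where
  "induced_subgraph G W = \<lparr>verts = W, edges = {e \<in> edges G. e \<subseteq> W}\<rparr>"

definition delete_verts :: "'v graph \<Rightarrow> 'v set \<Rightarrow> 'v graph" where
  "delete_verts G W = induced_subgraph G (verts G - W)"

definition subgraph :: "'v graph \<Rightarrow> 'v graph \<Rightarrow> bool" where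
  "subgraph H G \<longleftrightarrow> simple_graph H \<and> verts H \<subseteq> verts G \<and> edges H \<subseteq> edges G"

definition reachable :: "'v graph \<Rightarrow> 'v \<Rightarrow> 'v \<Rightarrow> bool" where
  "reachable G = (\<lambda>u v. {u, v} \<in> edges G)\<^sup>*\<^sup>*"

definition connected_components :: "'v graph \<Rightarrow> 'v graph set" where
  "connected_components G =
     {induced_subgraph G {w \<in> verts G. reachable G v w} |v. v \<in> verts G}"

definition matching :: "'v graph \<Rightarrow> 'v set set \<Rightarrow> bool" where
  "matching G M \<longleftrightarrow> M \<subseteq> edges G \<and> pairwise disjnt M"

definition matching_number :: "'v graph \<Rightarrow> nat" where
  "matching_number G = Max {card M |M. matching G M}"

definition family_subgraph :: "nat graph set \<Rightarrow> 'v graph \<Rightarrow> 'v graph \<Rightarrow> bool" where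
  "family_subgraph \<H> H G \<longleftrightarrow> subgraph H G \<and> verts H \<noteq> {} \<and>
     (\<forall>C\<in>connected_components H. \<exists>D\<in>\<H>. graph_iso C D)"

definition maximal_family_subgraph :: "nat graph set \<Rightarrow> 'v graph \<Rightarrow> 'v graph \<Rightarrow> bool" where
  "maximal_family_subgraph \<H> H G \<longleftrightarrow>
     family_subgraph \<H> H G \<and> \<not> (\<exists>H'. family_subgraph \<H> H' (delete_verts G (verts H)))"

definition min_match :: "nat graph set \<Rightarrow> 'v graph \<Rightarrow> nat" where
  "min_match \<H> G =
     (if edges G = {} then 0
      else Min {matching_number H |H. maximal_family_subgraph \<H> H G})"

section \<open>Polynomial rings and edge ideals\<close>

type_synonym ('v, 'k) mpoly = "('v \<Rightarrow>\<^sub>0 nat) \<Rightarrow>\<^sub>0 'k"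

text \<open>The polynomial ring with one variable for every element of \<open>V\<close>: the polynomials all of
  whose monomials involve only variables from \<open>V\<close>.\<close>
definition mpoly_ring :: "'v set \<Rightarrow> ('v, 'k::field) mpoly ring" where
  "mpoly_ring V = \<lparr>carrier = {p. \<forall>m\<in>Poly_Mapping.keys p. Poly_Mapping.keys m \<subseteq> V},
     mult = (*), one = 1, zero = 0, add = (+)\<rparr>"

definition var :: "'v \<Rightarrow> ('v, 'k::field) mpoly" where
  "var v = Poly_Mapping.single (Poly_Mapping.single v 1) 1"

definition monom_degree :: "('v \<Rightarrow>\<^sub>0 nat) \<Rightarrow> nat" where
  "monom_degree m = (\<Sum>v\<in>Poly_Mapping.keys m. Poly_Mapping.lookup m v)"

text \<open>The zero polynomial is homogeneous of every degree, and it is the only polynomial that is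
  homogeneous of negative degree.\<close>
definition homogeneous :: "int \<Rightarrow> ('v, 'k::field) mpoly \<Rightarrow> bool" where
  "homogeneous d p \<longleftrightarrow> (\<forall>m\<in>Poly_Mapping.keys p. int (monom_degree m) = d)"

definition edge_ideal :: "'v graph \<Rightarrow> ('v, 'k::field) mpoly set" where
  "edge_ideal G = Idl\<^bsub>mpoly_ring (verts G)\<^esub> {var u * var v |u v. {u, v} \<in> edges G}"

text \<open>\<open>R/I\<close> as an \<open>R\<close>-module, with underlying ring \<open>R Quot I\<close>.\<close>
definition quotient_module :: "('a, 'b) ring_scheme \<Rightarrow> 'a set \<Rightarrow> ('a, 'a set) module" where
  "quotient_module R I =
     ring.extend (R Quot I) (module.fields (\<lambda>a A. (I +>\<^bsub>R\<^esub> a) \<otimes>\<^bsub>R Quot I\<^esub> A))"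

definition quotient_grading :: "'v set \<Rightarrow> ('v, 'k::field) mpoly set \<Rightarrow> int \<Rightarrow> ('v, 'k) mpoly set set" where
  "quotient_grading V I d =
     {I +>\<^bsub>mpoly_ring V\<^esub> p |p. p \<in> carrier (mpoly_ring V) \<and> homogeneous d p}"

section \<open>Minimal graded free resolutions, Betti numbers and regularity\<close>

text \<open>
  A graded free resolution of a graded module \<open>M\<close> by finitely generated free modules is written
  down in homogeneous bases. The \<open>i\<close>-th free module \<open>F\<^sub>i\<close> has \<open>rank F i\<close> basis elements, the \<open>k\<close>-th
  of which has degree \<open>shift F i k\<close>, so that \<open>F\<^sub>i\<close> is the direct sum of the modules
  \<open>S(- shift F i k)\<close>. Row \<open>k\<close> of the matrix \<open>diff F i\<close> is the image in \<open>F\<^sub>i\<close> of the \<open>k\<close>-th basis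
  element of \<open>F\<^sub>i\<^sub>+\<^sub>1\<close>, and \<open>aug F k\<close> is the image in \<open>M\<close> of the \<open>k\<close>-th basis element of \<open>F\<^sub>0\<close>.
\<close>
record ('p, 'm) free_res =
  rank :: "nat \<Rightarrow> nat"
  shift :: "nat \<Rightarrow> nat \<Rightarrow> int"
  diff :: "nat \<Rightarrow> nat \<Rightarrow> nat \<Rightarrow> 'p"
  aug :: "nat \<Rightarrow> 'm"

definition free_carrier ::
  "'v set \<Rightarrow> (('v, 'k::field) mpoly, 'm) free_res \<Rightarrow> nat \<Rightarrow> (nat \<Rightarrow> ('v, 'k) mpoly) set" where
  "free_carrier V F i =
     {v. (\<forall>k<rank F i. v k \<in> carrier (mpoly_ring V)) \<and> (\<forall>k\<ge>rank F i. v k = 0)}"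

definition diff_map ::
  "(('v, 'k::field) mpoly, 'm) free_res \<Rightarrow> nat \<Rightarrow> (nat \<Rightarrow> ('v, 'k) mpoly) \<Rightarrow> nat \<Rightarrow> ('v, 'k) mpoly" where
  "diff_map F i v = (\<lambda>l. if l < rank F i then \<Sum>k<rank F (Suc i). v k * diff F i k l else 0)"

definition aug_map ::
  "(('v, 'k::field) mpoly, 'm) module \<Rightarrow> (('v, 'k) mpoly, 'm) free_res
     \<Rightarrow> (nat \<Rightarrow> ('v, 'k) mpoly) \<Rightarrow> 'm" where
  "aug_map M F v = (\<Oplus>\<^bsub>M\<^esub>k\<in>{..<rank F 0}. v k \<odot>\<^bsub>M\<^esub> aug F k)"

text \<open>Here \<open>Mg d\<close> is the homogeneous component of \<open>M\<close> of degree \<open>d\<close>.\<close>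
definition graded_free_resolution ::
  "'v set \<Rightarrow> (('v, 'k::field) mpoly, 'm) module \<Rightarrow> (int \<Rightarrow> 'm set)
     \<Rightarrow> (('v, 'k) mpoly, 'm) free_res \<Rightarrow> bool" where
  "graded_free_resolution V M Mg F \<longleftrightarrow>
     (\<forall>k<rank F 0. aug F k \<in> Mg (shift F 0 k)) \<and>
     (\<forall>i. \<forall>k<rank F (Suc i). \<forall>l<rank F i. diff F i k l \<in> carrier (mpoly_ring V) \<and>
        homogeneous (shift F (Suc i) k - shift F i l) (diff F i k l)) \<and>
     aug_map M F ` free_carrier V F 0 = carrier M \<and>
     {v \<in> free_carrier V F 0. aug_map M F v = \<zero>\<^bsub>M\<^esub>} = diff_map F 0 ` free_carrier V F 1 \<and>
     (\<forall>i. {v \<in> free_carrier V F (Suc i). diff_map F i v = (\<lambda>_. 0)} =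
          diff_map F (Suc i) ` free_carrier V F (Suc (Suc i)))"

text \<open>Minimality: every differential maps \<open>F\<^sub>i\<^sub>+\<^sub>1\<close> into \<open>\<mm>F\<^sub>i\<close>, where \<open>\<mm>\<close> is generated by the
  variables, i.e. no matrix entry has a constant term.\<close>
definition minimal_graded_free_resolution ::
  "'v set \<Rightarrow> (('v, 'k::field) mpoly, 'm) module \<Rightarrow> (int \<Rightarrow> 'm set)
     \<Rightarrow> (('v, 'k) mpoly, 'm) free_res \<Rightarrow> bool" where
  "minimal_graded_free_resolution V M Mg F \<longleftrightarrow>
     graded_free_resolution V M Mg F \<and>
     (\<forall>i. \<forall>k<rank F (Suc i). \<forall>l<rank F i. Poly_Mapping.lookup (diff F i k l) 0 = 0)"

text \<open>The number of copies of \<open>S(-j)\<close> in step \<open>i\<close> of a minimal graded free resolution. For a finitely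
  generated graded module over a polynomial ring in finitely many variables such a resolution
  exists and any two are isomorphic, so the choice is immaterial.\<close>
definition graded_betti ::
  "'v set \<Rightarrow> (('v, 'k::field) mpoly, 'm) module \<Rightarrow> (int \<Rightarrow> 'm set) \<Rightarrow> nat \<Rightarrow> int \<Rightarrow> nat" where
  "graded_betti V M Mg i j =
     (let F = (SOME F. minimal_graded_free_resolution V M Mg F)
      in card {k. k < rank F i \<and> shift F i k = j})"

text \<open>Only meaningful for nonzero \<open>M\<close>, as otherwise the maximum is over the empty set.\<close>
definition regularity ::
  "'v set \<Rightarrow> (('v, 'k::field) mpoly, 'm) module \<Rightarrow> (int \<Rightarrow> 'm set) \<Rightarrow> int" where
  "regularity V M Mg = Max {j - int i |i j. graded_betti V M Mg i j \<noteq> 0}"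

text \<open>\<open>reg(S/I)\<close> for a homogeneous ideal \<open>I\<close> of \<open>S = K[V]\<close>, with the standard grading.\<close>
definition reg_quotient :: "'v set \<Rightarrow> ('v, 'k::field) mpoly set \<Rightarrow> int" where
  "reg_quotient V I = regularity V (quotient_module (mpoly_ring V) I) (quotient_grading V I)"

end

theory Submission
  imports Defs
begin

text \<open>
  Write \<open>S = K[V]\<close> and let \<open>P\<close> be a graded free resolution of the residue field. Resolutions exist by
  Hilbert's basis theorem. If \<open>F\<close> is any minimal graded free resolution of \<open>S/I\<close>, dimension
  shifting along \<open>F\<close> shows that a generator of degree \<open>j\<close> of \<open>F\<^sub>i\<close> yields a nonzero class in
  \<open>H\<^sub>i(P \<otimes> S/I)\<^sub>j\<close>, so it suffices to make these groups vanish for \<open>j > i + r\<close>. By half-exactness on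
  \<open>0 \<rightarrow> S/(I : x)(-1) \<rightarrow> S/I \<rightarrow> S/(I, x) \<rightarrow> 0\<close> the bound \<open>r\<close> for a graph \<open>G\<close> follows from the bound \<open>r\<close> for
  \<open>G - x\<close> and the bound \<open>r - 1\<close> for \<open>G - N[x]\<close>. Hence deleting the two ends of an edge lowers the
  bound by at most one, and deleting a cycle \<open>C\<^sub>k\<close> lowers it by at most \<open>\<lfloor>k/2\<rfloor>\<close>: an even cycle has a
  perfect matching, and for an odd one both \<open>C\<^sub>k - x\<close> and \<open>C\<^sub>k - N[x]\<close> do. As \<open>K\<^sub>2\<close> is in the family,
  a maximal subgraph leaves an independent set, for which the bound is \<open>0\<close>.
\<close>

text \<open>\<open>graded_betti\<close> looks at one resolution \<open>F\<close> picked by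
  \<open>SOME\<close>, of which only minimality is known; a priori its first free module may have
  any rank. Uniqueness of minimal resolutions and the symmetry of Tor are both bypassed: what is
  proved is the single implication from a generator of \<open>F\<close> to a homology class of P
  tensored with S/I, for arbitrary minimal \<open>F\<close>. Removing a vertex replaces I by (I, x)
  or by the colon ideal I : x, and both may contain variables, so edge ideals alone are not closed
  under the recursion. Therefore S and \<open>P\<close> stay fixed, and the recursion runs over
  ideals generated by the edges inside a vertex set U and by a set Z of variables outside U; the
  variables in Z do not raise the bound. The maximum that defines the regularity has to be taken
  over a finite set. In place of finite length of resolutions, the proof uses that the degrees in a
  minimal resolution grow by at least one per step: the values j - i are bounded below, and the
  vanishing bounds them above.\<close>

abbreviation "keys \<equiv> Poly_Mapping.keys"
abbreviation "lookup \<equiv> Poly_Mapping.lookup"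
abbreviation "single \<equiv> Poly_Mapping.single"

section \<open>Polynomials\<close>

definition polys :: "'v set \<Rightarrow> ('v, 'k::field) mpoly set" where
  "polys V = {p. \<forall>m\<in>keys p. keys m \<subseteq> V}"

lemma carrier_mpoly_ring [simp]: "carrier (mpoly_ring V) = polys V"
  by (simp add: mpoly_ring_def polys_def)

lemma polys_0 [simp, intro]: "0 \<in> polys V"
  by (simp add: polys_def)

lemma polys_1 [simp, intro]: "1 \<in> polys V"
  by (simp add: polys_def)

lemma polys_single [intro]: "keys m \<subseteq> V \<Longrightarrow> single m c \<in> polys V"
  by (auto simp: polys_def split: if_splits)

lemma polys_add [intro]: "p \<in> polys V \<Longrightarrow> q \<in> polys V \<Longrightarrow> p + q \<in> polys V"
  using keys_add[of p q] by (auto simp: polys_def)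

lemma polys_uminus [intro]: "p \<in> polys V \<Longrightarrow> - p \<in> polys V"
  by (auto simp: polys_def in_keys_iff)

lemma polys_diff [intro]: "p \<in> polys V \<Longrightarrow> q \<in> polys V \<Longrightarrow> p - q \<in> polys V"
  using polys_add[of p V "- q"] by (auto intro: polys_uminus)

lemma keys_add_nat: "keys (m + m' :: 'v \<Rightarrow>\<^sub>0 nat) = keys m \<union> keys m'"
  by (auto simp: in_keys_iff lookup_add)

lemma polys_mult [intro]: "p \<in> polys V \<Longrightarrow> q \<in> polys V \<Longrightarrow> p * q \<in> polys V"
  using keys_mult[of p q] unfolding polys_def by (fastforce simp: keys_add_nat)

lemma polys_sum [intro]: "(\<And>x. x \<in> A \<Longrightarrow> f x \<in> polys V) \<Longrightarrow> (\<Sum>x\<in>A. f x) \<in> polys V"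
  by (induction A rule: infinite_finite_induct) auto

lemma lookup_single_mult_add:
  "lookup (single a c * g) (a + m) = c * lookup (g :: ('v, 'k::field) mpoly) m"
  by (simp add: lookup_mult lookup_single when_mult)

lemma keys_single_mult: "keys (single a c * g) \<subseteq> (\<lambda>m. a + m) ` keys (g :: ('v, 'k::field) mpoly)"
  using keys_mult[of "single a c" g] by (auto split: if_splits)

text \<open>Exponents are natural numbers, so a product of monomials is 1 only if both factors are.
  This makes the absence of constant terms, hence minimality, stable under linear
  combinations.\<close>

lemma lookup_mult_0:
  "lookup (p * q) 0 = lookup p 0 * lookup (q :: ('v, 'k::field) mpoly) 0"
proof -
  have iff: "a + b = 0 \<longleftrightarrow> a = 0 \<and> b = 0" for a b :: "'v \<Rightarrow>\<^sub>0 nat"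
    by (auto simp: poly_mapping_eq_iff lookup_add fun_eq_iff)
  have "lookup (p * q) 0 = (\<Sum>a. lookup p a * (\<Sum>b. lookup q b when 0 = a + b))"
    by (rule lookup_mult)
  also have "\<dots> = (\<Sum>a. lookup p a * lookup q 0 when a = 0)"
  proof (rule Sum_any.cong)
    fix a :: "'v \<Rightarrow>\<^sub>0 nat"
    show "lookup p a * (\<Sum>b. lookup q b when 0 = a + b) = (lookup p a * lookup q 0 when a = 0)"
      by (cases "a = 0") (simp_all add: iff)
  qed
  finally show ?thesis by simp
qed

section \<open>Selecting terms of a polynomial by a predicate\<close>

definition terms_with :: "(('v \<Rightarrow>\<^sub>0 nat) \<Rightarrow> bool) \<Rightarrow> ('v, 'k::field) mpoly \<Rightarrow> ('v, 'k) mpoly" where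
  "terms_with P p = Poly_Mapping.mapp (\<lambda>m c. c when P m) p"

lemma lookup_terms_with: "lookup (terms_with P p) m = (lookup p m when P m)"
  by (simp add: terms_with_def lookup_mapp in_keys_iff when_def)

lemma keys_terms_with: "keys (terms_with P p) = {m \<in> keys p. P m}"
  by (auto simp: in_keys_iff lookup_terms_with)

lemma terms_with_in_polys [intro]: "p \<in> polys V \<Longrightarrow> terms_with P p \<in> polys V"
  by (auto simp: polys_def keys_terms_with)

lemma terms_with_0 [simp]: "terms_with P 0 = 0"
  by (rule poly_mapping_eqI) (simp add: lookup_terms_with)

lemma terms_with_add: "terms_with P (p + q) = terms_with P p + terms_with P q"
  by (rule poly_mapping_eqI) (simp add: lookup_terms_with lookup_add when_def)

lemma terms_with_diff: "terms_with P (p - q) = terms_with P p - terms_with P q"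
  by (rule poly_mapping_eqI) (simp add: lookup_terms_with lookup_minus when_def)

lemma terms_with_sum: "terms_with P (\<Sum>x\<in>A. f x) = (\<Sum>x\<in>A. terms_with P (f x))"
  by (induction A rule: infinite_finite_induct) (auto simp: terms_with_add)

lemma terms_with_split: "p = terms_with P p + terms_with (\<lambda>m. \<not> P m) p"
  by (rule poly_mapping_eqI) (simp add: lookup_terms_with lookup_add when_def)

lemma terms_with_idem: "\<forall>m\<in>keys p. P m \<Longrightarrow> terms_with P p = p"
  by (rule poly_mapping_eqI) (auto simp: lookup_terms_with when_def in_keys_iff)

lemma terms_with_none: "\<forall>m\<in>keys p. \<not> P m \<Longrightarrow> terms_with P p = 0"
  by (rule poly_mapping_eqI) (auto simp: lookup_terms_with when_def in_keys_iff)


section \<open>Homogeneous components\<close>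

definition hcomp :: "int \<Rightarrow> ('v, 'k::field) mpoly \<Rightarrow> ('v, 'k) mpoly" where
  "hcomp d = terms_with (\<lambda>m. int (monom_degree m) = d)"

lemma monom_degree_superset:
  "finite A \<Longrightarrow> keys m \<subseteq> A \<Longrightarrow> monom_degree m = (\<Sum>v\<in>A. lookup m v)"
  unfolding monom_degree_def by (rule sum.mono_neutral_left) (auto simp: in_keys_iff)

lemma monom_degree_add: "monom_degree (m + m') = monom_degree m + monom_degree m'"
  by (simp add: monom_degree_superset[of "keys m \<union> keys m'"] keys_add_nat lookup_add
      sum.distrib)

lemma monom_degree_0 [simp]: "monom_degree 0 = 0"
  by (simp add: monom_degree_def)

lemma monom_degree_single [simp]: "monom_degree (single v n) = n"
  by (simp add: monom_degree_def)

lemma monom_degree_eq_0: "monom_degree m = 0 \<longleftrightarrow> m = 0"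
  by (auto simp: monom_degree_def in_keys_iff poly_mapping_eq_iff fun_eq_iff)

lemma homogeneous_0 [simp, intro]: "homogeneous d 0"
  by (simp add: homogeneous_def)

lemma homogeneous_add [intro]: "homogeneous d p \<Longrightarrow> homogeneous d q \<Longrightarrow> homogeneous d (p + q)"
  using keys_add[of p q] by (auto simp: homogeneous_def)

lemma homogeneous_diff [intro]: "homogeneous d p \<Longrightarrow> homogeneous d q \<Longrightarrow> homogeneous d (p - q)"
  using keys_diff[of p q] by (auto simp: homogeneous_def)

lemma homogeneous_mult [intro]:
  "homogeneous d p \<Longrightarrow> homogeneous e q \<Longrightarrow> homogeneous (d + e) (p * q)"
  using keys_mult[of p q] unfolding homogeneous_def by (fastforce simp: monom_degree_add)

lemma homogeneous_sum [intro]: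
  "(\<And>x. x \<in> A \<Longrightarrow> homogeneous d (f x)) \<Longrightarrow> homogeneous d (\<Sum>x\<in>A. f x)"
  by (induction A rule: infinite_finite_induct) auto

lemma homogeneous_1 [simp, intro]: "homogeneous 0 1"
  by (simp add: homogeneous_def)

lemma homogeneous_hcomp [simp, intro]: "homogeneous d (hcomp d p)"
  by (simp add: homogeneous_def hcomp_def keys_terms_with)

lemma hcomp_homogeneous: "homogeneous e p \<Longrightarrow> hcomp d p = (if d = e then p else 0)"
  by (auto simp: hcomp_def homogeneous_def intro!: terms_with_idem terms_with_none)

lemma hcomp_in_polys [intro]: "p \<in> polys V \<Longrightarrow> hcomp d p \<in> polys V"
  by (auto simp: hcomp_def)

lemma hcomp_0 [simp]: "hcomp d 0 = 0"
  by (simp add: hcomp_def)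

lemma hcomp_add: "hcomp d (p + q) = hcomp d p + hcomp d q"
  by (simp add: hcomp_def terms_with_add)

lemma hcomp_diff: "hcomp d (p - q) = hcomp d p - hcomp d q"
  by (simp add: hcomp_def terms_with_diff)

lemma hcomp_sum: "hcomp d (\<Sum>x\<in>A. f x) = (\<Sum>x\<in>A. hcomp d (f x))"
  by (simp add: hcomp_def terms_with_sum)

text \<open>As \<open>f\<close> is homogeneous of degree \<open>e\<close>, only the terms of
  \<open>p\<close> of degree \<open>d - e\<close> are carried to degree \<open>d\<close>; the rest
  \<open>?q\<close> contributes nothing there.\<close>

lemma hcomp_mult:
  assumes "homogeneous e f"
  shows "hcomp d (p * f) = hcomp (d - e) p * f"
proof -
  let ?q = "terms_with (\<lambda>m. int (monom_degree m) \<noteq> d - e) p"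
  have "hcomp d (?q * f) = 0"
    unfolding hcomp_def using keys_mult[of ?q f] assms
    by (intro terms_with_none) (fastforce simp: keys_terms_with homogeneous_def monom_degree_add)
  moreover have "hcomp d (hcomp (d - e) p * f) = hcomp (d - e) p * f"
    using homogeneous_mult[OF homogeneous_hcomp assms, of "d - e" p] by (simp add: hcomp_homogeneous)
  moreover have "p = hcomp (d - e) p + ?q"
    unfolding hcomp_def by (rule terms_with_split)
  hence "p * f = hcomp (d - e) p * f + ?q * f"
    using distrib_right[of "hcomp (d - e) p" ?q f] by argo
  ultimately show ?thesis
    by (simp add: hcomp_add)
qed

lemma sum_hcomp:
  assumes "finite D" "(\<lambda>m. int (monom_degree m)) ` keys p \<subseteq> D"
  shows "(\<Sum>d\<in>D. hcomp d p) = p"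
proof (rule poly_mapping_eqI)
  fix m
  show "lookup (\<Sum>d\<in>D. hcomp d p) m = lookup p m"
    using assms
    by (cases "m \<in> keys p") (auto simp: lookup_sum hcomp_def lookup_terms_with when_def in_keys_iff)
qed


section \<open>Submodules of free modules\<close>

definition vecs :: "'v set \<Rightarrow> nat \<Rightarrow> (nat \<Rightarrow> ('v, 'k::field) mpoly) set" where
  "vecs V n = {v. (\<forall>k<n. v k \<in> polys V) \<and> (\<forall>k\<ge>n. v k = 0)}"

lemma free_carrier_eq: "free_carrier V F i = vecs V (rank F i)"
  by (simp add: free_carrier_def vecs_def)

lemma vecs_polys: "v \<in> vecs V n \<Longrightarrow> v k \<in> polys V"
  by (cases "k < n") (auto simp: vecs_def)

definition submodule_of_vecs :: "'v set \<Rightarrow> nat \<Rightarrow> (nat \<Rightarrow> ('v, 'k::field) mpoly) set \<Rightarrow> bool" where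
  "submodule_of_vecs V n N \<longleftrightarrow> N \<subseteq> vecs V n \<and> (\<lambda>_. 0) \<in> N \<and>
     (\<forall>u\<in>N. \<forall>v\<in>N. (\<lambda>k. u k + v k) \<in> N) \<and>
     (\<forall>a\<in>polys V. \<forall>v\<in>N. (\<lambda>k. a * v k) \<in> N)"

lemma
  assumes "submodule_of_vecs V n N"
  shows submodule_vecs: "v \<in> N \<Longrightarrow> v \<in> vecs V n"
    and submodule_0: "(\<lambda>_. 0) \<in> N"
    and submodule_add: "u \<in> N \<Longrightarrow> v \<in> N \<Longrightarrow> (\<lambda>k. u k + v k) \<in> N"
    and submodule_mult: "a \<in> polys V \<Longrightarrow> v \<in> N \<Longrightarrow> (\<lambda>k. a * v k) \<in> N"
  using assms unfolding submodule_of_vecs_def by blast+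

lemma submodule_diff:
  assumes "submodule_of_vecs V n N" "u \<in> N" "v \<in> N"
  shows "(\<lambda>k. u k - v k) \<in> N"
proof -
  have "(\<lambda>k. u k + (-1) * v k) \<in> N"
    by (rule submodule_add[OF assms(1,2) submodule_mult[OF assms(1) _ assms(3)]]) auto
  thus ?thesis by simp
qed

lemma submodule_sum:
  assumes "submodule_of_vecs V n N" "\<And>x. x \<in> A \<Longrightarrow> f x \<in> N"
  shows "(\<lambda>k. \<Sum>x\<in>A. f x k) \<in> N"
  using assms(2)
  by (induction A rule: infinite_finite_induct)
     (auto intro: submodule_add[OF assms(1)] submodule_0[OF assms(1)])

text \<open>Coefficients are indexed by the generators themselves, which makes the removal of a
  generator easy to express. Sums over infinite sets are 0 by convention, so \<open>B\<close> is
  meant to be finite.\<close>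

definition combinations ::
  "'v set \<Rightarrow> (nat \<Rightarrow> ('v, 'k::field) mpoly) set \<Rightarrow> (nat \<Rightarrow> ('v, 'k) mpoly) set" where
  "combinations V B = {\<lambda>k. \<Sum>g\<in>B. a g * g k |a. \<forall>g\<in>B. a g \<in> polys V}"

lemma combinations_subset:
  "submodule_of_vecs V n N \<Longrightarrow> B \<subseteq> N \<Longrightarrow> combinations V B \<subseteq> N"
  by (auto simp: combinations_def intro!: submodule_sum submodule_mult)

lemma combinations_0: "(\<lambda>_. 0) \<in> combinations V B"
  unfolding combinations_def by (force intro!: exI[of _ "\<lambda>_. 0"])

lemma combinations_add:
  assumes "u \<in> combinations V B" "v \<in> combinations V B"
  shows "(\<lambda>k. u k + v k) \<in> combinations V B"
proof -
  obtain a b where "u = (\<lambda>k. \<Sum>g\<in>B. a g * g k)" "v = (\<lambda>k. \<Sum>g\<in>B. b g * g k)"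
    "\<forall>g\<in>B. a g \<in> polys V" "\<forall>g\<in>B. b g \<in> polys V"
    using assms by (auto simp: combinations_def)
  hence "(\<lambda>k. u k + v k) = (\<lambda>k. \<Sum>g\<in>B. (a g + b g) * g k)" "\<forall>g\<in>B. a g + b g \<in> polys V"
    by (auto simp: sum.distrib distrib_right)
  thus ?thesis
    unfolding combinations_def by (intro CollectI exI[of _ "\<lambda>g. a g + b g"]) simp
qed

lemma combinations_mult:
  assumes "b \<in> polys V" "u \<in> combinations V B"
  shows "(\<lambda>k. b * u k) \<in> combinations V B"
proof -
  obtain a where "u = (\<lambda>k. \<Sum>g\<in>B. a g * g k)" "\<forall>g\<in>B. a g \<in> polys V"
    using assms by (auto simp: combinations_def)
  hence "(\<lambda>k. b * u k) = (\<lambda>k. \<Sum>g\<in>B. (b * a g) * g k)" "\<forall>g\<in>B. b * a g \<in> polys V"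
    using assms by (auto simp: sum_distrib_left mult.assoc)
  thus ?thesis
    unfolding combinations_def by (intro CollectI exI[of _ "\<lambda>g. b * a g"]) simp
qed

lemma combinations_self:
  assumes "finite B" "g \<in> B"
  shows "g \<in> combinations V B"
proof -
  have "g = (\<lambda>k. \<Sum>h\<in>B. (if h = g then 1 else 0) * h k)"
    using assms by (auto simp: if_distrib[of "\<lambda>x. x * _"] sum.delta' cong: if_cong)
  thus ?thesis
    unfolding combinations_def by (intro CollectI exI[of _ "\<lambda>h. if h = g then 1 else 0"]) auto
qed

lemma combinations_sum:
  assumes "\<And>x. x \<in> A \<Longrightarrow> f x \<in> combinations V B"
  shows "(\<lambda>k. \<Sum>x\<in>A. f x k) \<in> combinations V B"
  using assms
  by (induction A rule: infinite_finite_induct) (auto intro: combinations_add combinations_0)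

lemma combinations_trans:
  assumes "\<And>g. g \<in> B \<Longrightarrow> g \<in> combinations V C"
  shows "combinations V B \<subseteq> combinations V C"
  using assms by (auto simp: combinations_def[of V B] intro!: combinations_sum combinations_mult)


section \<open>Hilbert's basis theorem\<close>

text \<open>Induction on the set of coordinates. The set \<open>B\<close> obtained for
  \<open>X\<close> serves every \<open>a\<close> with \<open>a x\<close> at least \<open>M\<close>,
  the sum of all \<open>b x\<close>; the other elements lie in the finitely many slices
  \<open>a x = i\<close> with \<open>i < M\<close>, and the induction hypothesis applies to each
  slice.\<close>

lemma Dickson:
  fixes A :: "('a \<Rightarrow> nat) set"
  assumes "finite X"
  shows "\<exists>B\<subseteq>A. finite B \<and> (\<forall>a\<in>A. \<exists>b\<in>B. \<forall>x\<in>X. b x \<le> a x)"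
  using assms
proof (induction X arbitrary: A)
  case empty
  show ?case
  proof (cases "A = {}")
    case False
    then obtain a where "a \<in> A" by blast
    thus ?thesis by (intro exI[of _ "{a}"]) simp
  next
    case True
    thus ?thesis by (intro exI[of _ "{}"]) simp
  qed
next
  case (insert x X)
  obtain B where B: "B \<subseteq> A" "finite B" "\<forall>a\<in>A. \<exists>b\<in>B. \<forall>y\<in>X. b y \<le> a y"
    using insert.IH[of A] by (elim exE conjE)
  have "\<forall>i. \<exists>C\<subseteq>{a\<in>A. a x = i}. finite C \<and> (\<forall>a\<in>{a\<in>A. a x = i}. \<exists>b\<in>C. \<forall>y\<in>X. b y \<le> a y)"
    by (intro allI insert.IH)
  from choice[OF this] obtain C where C: "\<forall>i. C i \<subseteq> {a\<in>A. a x = i} \<and> finite (C i) \<and>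
    (\<forall>a\<in>{a\<in>A. a x = i}. \<exists>b\<in>C i. \<forall>y\<in>X. b y \<le> a y)" ..
  define M where "M = (\<Sum>b\<in>B. b x)"
  have M: "b x \<le> M" if "b \<in> B" for b
    unfolding M_def using B(2) that by (intro member_le_sum) auto
  show ?case
  proof (intro exI[of _ "B \<union> (\<Union>i<M. C i)"] conjI ballI)
    fix a assume a: "a \<in> A"
    show "\<exists>b\<in>B \<union> (\<Union>i<M. C i). \<forall>y\<in>insert x X. b y \<le> a y"
    proof (cases "a x < M")
      case True
      obtain b where b: "b \<in> C (a x)" "\<forall>y\<in>X. b y \<le> a y" using C a by blast
      moreover have "b x = a x" using C b by blast
      ultimately show ?thesis using True by (intro bexI[of _ b]) auto
    next
      case False
      then obtain b where "b \<in> B" "\<forall>y\<in>X. b y \<le> a y" using B(3) a by blast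
      moreover from this have "b x \<le> a x" using False M[of b] by simp
      ultimately show ?thesis by (intro bexI[of _ b]) auto
    qed
  next
    show "B \<union> (\<Union>i<M. C i) \<subseteq> A" using B(1) C by blast
    show "finite (B \<union> (\<Union>i<M. C i))" using B(2) C by simp
  qed
qed

text \<open>The lexicographic order, built from one variable of \<open>V\<close> at a time.
  Exponents that agree on \<open>V\<close> may stay incomparable, so totality is claimed only for
  exponents that differ on \<open>V\<close>.\<close>

lemma ex_monomial_order:
  assumes "finite V"
  shows "\<exists>r :: ('v \<Rightarrow>\<^sub>0 nat) rel. wf r \<and> trans r \<and>
           (\<forall>m m'. (\<exists>v\<in>V. lookup m v \<noteq> lookup m' v) \<longrightarrow> (m, m') \<in> r \<or> (m', m) \<in> r) \<and>
           (\<forall>m m' a. (m, m') \<in> r \<longrightarrow> (a + m, a + m') \<in> r)"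
  using assms
proof induction
  case empty
  show ?case by (rule exI[of _ "{}"]) auto
next
  case (insert x V)
  then obtain r :: "('v \<Rightarrow>\<^sub>0 nat) rel" where r: "wf r" "trans r"
    "\<And>m m'. (\<exists>v\<in>V. lookup m v \<noteq> lookup m' v) \<Longrightarrow> (m, m') \<in> r \<or> (m', m) \<in> r"
    "\<And>m m' a. (m, m') \<in> r \<Longrightarrow> (a + m, a + m') \<in> r" by blast
  let ?r = "inv_image (less_than <*lex*> r) (\<lambda>m. (lookup m x, m))"
  have "wf ?r" "trans ?r"
    using r(1,2) by (auto intro: trans_inv_image trans_lex_prod)
  moreover have "(m, m') \<in> ?r \<or> (m', m) \<in> ?r" if "\<exists>v\<in>insert x V. lookup m v \<noteq> lookup m' v" for m m'
    using that r(3)[of m m'] by (cases "lookup m x" "lookup m' x" rule: linorder_cases) auto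
  moreover have "(a + m, a + m') \<in> ?r" if "(m, m') \<in> ?r" for m m' a
    using that r(4) by (auto simp: lookup_add)
  ultimately show ?case by blast
qed

lemma finite_has_greatest:
  assumes "finite T" "T \<noteq> {}" "trans r" "\<And>s t. s \<in> T \<Longrightarrow> t \<in> T \<Longrightarrow> s \<noteq> t \<Longrightarrow> (s, t) \<in> r \<or> (t, s) \<in> r"
  shows "\<exists>t\<in>T. \<forall>s\<in>T. s = t \<or> (s, t) \<in> r"
  using assms(1,2,4)
proof (induction rule: finite_ne_induct)
  case (insert x T)
  then obtain t where t: "t \<in> T" "\<forall>s\<in>T. s = t \<or> (s, t) \<in> r" by blast
  have "(x, t) \<in> r \<or> (t, x) \<in> r" using insert t by blast
  thus ?case using t assms(3) by (metis insert_iff transD)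
qed auto

text \<open>Division by leading terms. A term is a position \<open>k\<close> together with an
  exponent; Dickson's lemma selects finitely many leading exponents in each position, and elements
  of \<open>N\<close> with these leading terms generate, since subtracting a suitable multiple of
  one of them lowers the leading term of any vector in \<open>N\<close>.\<close>

theorem Hilbert_basis:
  assumes V: "finite V" and N: "submodule_of_vecs V n (N :: (nat \<Rightarrow> ('v, 'k::field) mpoly) set)"
  shows "\<exists>B\<subseteq>N. finite B \<and> combinations V B = N"
proof -
  obtain r0 :: "('v \<Rightarrow>\<^sub>0 nat) rel" where r0: "wf r0" "trans r0"
    "\<And>m m'. (\<exists>v\<in>V. lookup m v \<noteq> lookup m' v) \<Longrightarrow> (m, m') \<in> r0 \<or> (m', m) \<in> r0"
    "\<And>m m' a. (m, m') \<in> r0 \<Longrightarrow> (a + m, a + m') \<in> r0" using ex_monomial_order[OF V] by blast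
  define r where "r = less_than <*lex*> r0"
  have r: "wf r" "trans r"
    unfolding r_def using r0 by (auto intro: trans_lex_prod)
  define ts where "ts v = {(k, m). m \<in> keys (v k)}" for v :: "nat \<Rightarrow> ('v, 'k) mpoly"
  have ts_fin: "finite (ts v)" and ts_lt: "(k, m) \<in> ts v \<Longrightarrow> k < n \<and> keys m \<subseteq> V"
    if "v \<in> N" for v k m
  proof -
    have v: "v \<in> vecs V n" using submodule_vecs[OF N] that .
    have "ts v \<subseteq> Sigma {..<n} (\<lambda>k. keys (v k))"
      using v by (auto simp: ts_def vecs_def) (metis keys_zero empty_iff leI)
    thus "finite (ts v)" by (rule finite_subset) auto
    show "k < n \<and> keys m \<subseteq> V" if "(k, m) \<in> ts v"
      using v that by (cases "k < n") (auto simp: ts_def vecs_def polys_def)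
  qed
  define lt where "lt v t \<longleftrightarrow> t \<in> ts v \<and> (\<forall>s\<in>ts v. s = t \<or> (s, t) \<in> r)" for v t
  have ex_lt: "\<exists>t. lt v t" if v: "v \<in> N" "v \<noteq> (\<lambda>_. 0)" for v
  proof -
    have "ts v \<noteq> {}" using v(2) by (force simp: ts_def fun_eq_iff)
    moreover have "(s, t) \<in> r \<or> (t, s) \<in> r" if st: "s \<in> ts v" "t \<in> ts v" "s \<noteq> t" for s t
    proof -
      obtain k m k' m' where eq: "s = (k, m)" "t = (k', m')" by (cases s, cases t)
      have "\<exists>v\<in>V. lookup m v \<noteq> lookup m' v" if "m \<noteq> m'"
      proof -
        obtain x where "lookup m x \<noteq> lookup m' x" using \<open>m \<noteq> m'\<close> by (metis poly_mapping_eqI)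
        moreover from this have "x \<in> keys m \<union> keys m'" by (auto simp: in_keys_iff)
        ultimately show ?thesis
          using ts_lt[OF v(1)] st eq by blast
      qed
      thus ?thesis
        using r0(3)[of m m'] st(3) unfolding r_def eq
        by (cases k k' rule: linorder_cases) auto
    qed
    ultimately show ?thesis
      using finite_has_greatest[OF ts_fin[OF v(1)] _ r(2)] unfolding lt_def by blast
  qed
  define L where "L k = {m. \<exists>v\<in>N. lt v (k, m)}" for k
  have "\<exists>B. B \<subseteq> L k \<and> finite B \<and> (\<forall>m\<in>L k. \<exists>m'\<in>B. \<forall>x\<in>V. lookup m' x \<le> lookup m x)" for k
  proof -
    obtain B where B: "B \<subseteq> lookup ` L k" "finite B" "\<forall>a\<in>lookup ` L k. \<exists>b\<in>B. \<forall>x\<in>V. b x \<le> a x"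
      using Dickson[OF V] by meson
    obtain B' where "B' \<subseteq> L k" "finite B'" "B = lookup ` B'"
      using finite_subset_image[OF B(2,1)] by blast
    thus ?thesis using B(3) by (intro exI[of _ B']) auto
  qed
  then obtain B where B: "\<And>k. B k \<subseteq> L k" "\<And>k. finite (B k)"
    "\<And>k m. m \<in> L k \<Longrightarrow> \<exists>m'\<in>B k. \<forall>x\<in>V. lookup m' x \<le> lookup m x"
    by metis
  have "\<forall>k. \<forall>m\<in>B k. \<exists>v\<in>N. lt v (k, m)" using B(1) by (auto simp: L_def)
  then obtain g where g: "\<And>k m. m \<in> B k \<Longrightarrow> g k m \<in> N \<and> lt (g k m) (k, m)" by metis
  define G where "G = (\<Union>k<n. g k ` B k)"
  have GN: "G \<subseteq> N" "finite G" unfolding G_def using g B(2) by auto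
  have red: "v \<in> combinations V G" if "lt v t" "v \<in> N" for v t
    using that
  proof (induction t arbitrary: v rule: wf_induct_rule[OF r(1)])
    case (1 t)
    obtain k m where t: "t = (k, m)" by (cases t)
    have k: "k < n" "keys m \<subseteq> V" using ts_lt[OF 1(3)] 1(2) t by (auto simp: lt_def)
    have "m \<in> L k" using 1 t by (auto simp: L_def)
    then obtain m' where m': "m' \<in> B k" "\<forall>x\<in>V. lookup m' x \<le> lookup m x" using B(3) by blast
    define h where "h = g k m'"
    have h: "h \<in> N" "lt h (k, m')" "h \<in> G" using g m'(1) k by (auto simp: h_def G_def)
    have km': "keys m' \<subseteq> V" using ts_lt[OF h(1), of k m'] h(2) by (auto simp: lt_def)
    define a where "a = m - m'"
    \<comment> \<open>Subtraction of exponents truncates, so \<open>m'\<close> must divide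
      \<open>m\<close> in every variable: on \<open>V\<close> by the choice of \<open>m'\<close>,
      elsewhere because \<open>m'\<close> involves no variable outside \<open>V\<close>.\<close>
    have m: "m = a + m'"
    proof (rule poly_mapping_eqI)
      fix x show "lookup m x = lookup (a + m') x"
        using m'(2) km' not_in_keys_iff_lookup_eq_zero[of x m']
        by (cases "x \<in> V") (auto simp: a_def lookup_add lookup_minus)
    qed
    \<comment> \<open>This scalar cancels the leading coefficients, so \<open>t\<close> is not a
      term of \<open>w\<close>; every term of \<open>w\<close> comes from \<open>v\<close> or from
      the shifted \<open>h\<close>, hence none exceeds \<open>t\<close>.\<close>
    define c where "c = lookup (v k) m / lookup (h k) m'"
    have hk: "lookup (h k) m' \<noteq> 0" using h(2) by (auto simp: lt_def ts_def in_keys_iff)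
    have ap: "single a c \<in> polys V"
      using k(2) by (intro polys_single) (auto simp: m keys_add_nat)
    define w where "w = (\<lambda>j. v j - single a c * h j)"
    have wN: "w \<in> N"
      unfolding w_def by (intro submodule_diff[OF N 1(3)] submodule_mult[OF N] ap h(1))
    have "w \<in> combinations V G"
    proof (cases "w = (\<lambda>_. 0)")
      case False
      then obtain s where s: "lt w s" using ex_lt wN by blast
      obtain j q where jq: "s = (j, q)" by (cases s)
      have q: "q \<in> keys (w j)" using s jq by (auto simp: lt_def ts_def)
      have "s \<noteq> t"
      proof
        assume "s = t"
        hence "lookup (w k) m \<noteq> 0" using q jq t by (auto simp: in_keys_iff)
        thus False using lookup_single_mult_add[of a c "h k" m'] hk
          by (simp add: w_def m[symmetric] lookup_minus c_def)
      qed
      moreover have "s = t \<or> (s, t) \<in> r"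
      proof -
        have "q \<in> keys (v j) \<or> q \<in> keys (single a c * h j)"
          using q keys_diff[of "v j" "single a c * h j"] by (auto simp: w_def)
        thus ?thesis
        proof
          assume "q \<in> keys (v j)"
          thus ?thesis using 1(2) by (auto simp: lt_def ts_def jq)
        next
          assume "q \<in> keys (single a c * h j)"
          then obtain q' where q': "q = a + q'" "q' \<in> keys (h j)" using keys_single_mult by blast
          hence "(j, q') = (k, m') \<or> ((j, q'), (k, m')) \<in> r" using h(2) by (auto simp: lt_def ts_def)
          thus ?thesis using r0(4)[of q' m' a] by (auto simp: jq t m q'(1) r_def)
        qed
      qed
      ultimately show ?thesis using 1(1) s wN by blast
    qed (simp add: combinations_0)
    hence "(\<lambda>j. w j + single a c * h j) \<in> combinations V G"
      by (rule combinations_add[OF _ combinations_mult[OF ap combinations_self[OF GN(2) h(3)]]])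
    thus ?case by (simp add: w_def)
  qed
  have "v \<in> combinations V G" if "v \<in> N" for v
    using red ex_lt combinations_0 that by metis
  thus ?thesis using combinations_subset[OF N GN(1)] GN by blast
qed


section \<open>Graded submodules and minimal free resolutions\<close>

text \<open>The \<open>k\<close>-th basis vector has degree \<open>s k\<close>.\<close>
definition homogeneous_vec :: "(nat \<Rightarrow> int) \<Rightarrow> int \<Rightarrow> (nat \<Rightarrow> ('v, 'k::field) mpoly) \<Rightarrow> bool" where
  "homogeneous_vec s d v \<longleftrightarrow> (\<forall>k. homogeneous (d - s k) (v k))"

definition vhcomp :: "(nat \<Rightarrow> int) \<Rightarrow> int \<Rightarrow> (nat \<Rightarrow> ('v, 'k::field) mpoly) \<Rightarrow> nat \<Rightarrow> ('v, 'k) mpoly" where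
  "vhcomp s d v = (\<lambda>k. hcomp (d - s k) (v k))"

definition graded_submodule ::
  "'v set \<Rightarrow> nat \<Rightarrow> (nat \<Rightarrow> int) \<Rightarrow> (nat \<Rightarrow> ('v, 'k::field) mpoly) set \<Rightarrow> bool" where
  "graded_submodule V n s N \<longleftrightarrow>
     submodule_of_vecs V n N \<and> (\<forall>v\<in>N. \<forall>d. vhcomp s d v \<in> N)"

lemma homogeneous_vhcomp [simp, intro]: "homogeneous_vec s d (vhcomp s d v)"
  by (simp add: homogeneous_vec_def vhcomp_def)

lemma hcomp_idem: "homogeneous d p \<Longrightarrow> hcomp d p = p"
  by (simp add: hcomp_homogeneous)

lemma vhcomp_homogeneous: "homogeneous_vec s d v \<Longrightarrow> vhcomp s d v = v"
  by (simp add: homogeneous_vec_def vhcomp_def hcomp_idem)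

lemma vhcomp_in_vecs [intro]: "v \<in> vecs V n \<Longrightarrow> vhcomp s d v \<in> vecs V n"
  by (auto simp: vecs_def vhcomp_def)

lemma vhcomp_diff: "vhcomp s d (\<lambda>k. u k - v k) = (\<lambda>k. vhcomp s d u k - vhcomp s d v k)"
  by (simp add: vhcomp_def hcomp_diff)

lemma vec_add [intro]: "u \<in> vecs V n \<Longrightarrow> v \<in> vecs V n \<Longrightarrow> (\<lambda>k. u k + v k) \<in> vecs V n"
  by (auto simp: vecs_def)

lemma vec_diff [intro]: "u \<in> vecs V n \<Longrightarrow> v \<in> vecs V n \<Longrightarrow> (\<lambda>k. u k - v k) \<in> vecs V n"
  by (auto simp: vecs_def)

lemma vec_mult [intro]: "a \<in> polys V \<Longrightarrow> v \<in> vecs V n \<Longrightarrow> (\<lambda>k. a * v k) \<in> vecs V n"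
  by (auto simp: vecs_def)

lemma vec_0 [simp, intro]: "(\<lambda>_. 0) \<in> vecs V n"
  by (auto simp: vecs_def)

lemma vec_sum_hcomp:
  assumes "v \<in> vecs V n"
  shows "\<exists>D. finite D \<and> v = (\<lambda>k. \<Sum>d\<in>D. vhcomp s d v k)"
proof -
  define D where "D = (\<Union>k<n. (\<lambda>m. int (monom_degree m) + s k) ` keys (v k))"
  have "(\<Sum>d\<in>D. vhcomp s d v k) = v k" for k
  proof (cases "k < n")
    case True
    have "(\<Sum>d\<in>D. vhcomp s d v k) = (\<Sum>d\<in>(\<lambda>d. d - s k) ` D. hcomp d (v k))"
      unfolding vhcomp_def by (subst sum.reindex) (auto simp: inj_on_def)
    also have "\<dots> = v k"
    proof (rule sum_hcomp)
      show "(\<lambda>m. int (monom_degree m)) ` keys (v k) \<subseteq> (\<lambda>d. d - s k) ` D"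
      proof
        fix e assume "e \<in> (\<lambda>m. int (monom_degree m)) ` keys (v k)"
        hence "e + s k \<in> D" unfolding D_def using True by blast
        thus "e \<in> (\<lambda>d. d - s k) ` D" by (intro image_eqI[of _ _ "e + s k"]) auto
      qed
    qed (auto simp: D_def)
    finally show ?thesis .
  next
    case False
    thus ?thesis using assms by (auto simp: vhcomp_def vecs_def)
  qed
  moreover have "finite D" by (auto simp: D_def)
  ultimately show ?thesis by (intro exI[of _ D]) auto
qed

section \<open>Homogeneous and minimal generating sets\<close>

lemma homogeneous_generators:
  assumes V: "finite V" and N: "graded_submodule V n s N"
  shows "\<exists>B\<subseteq>N. finite B \<and> combinations V B = N \<and> (\<forall>g\<in>B. \<exists>d. homogeneous_vec s d g)"
proof -
  have sub: "submodule_of_vecs V n N" and gr: "\<And>v d. v \<in> N \<Longrightarrow> vhcomp s d v \<in> N"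
    using N by (auto simp: graded_submodule_def)
  obtain B where B: "B \<subseteq> N" "finite B" "combinations V B = N"
    using Hilbert_basis[OF V sub] by blast
  have "\<forall>v\<in>B. \<exists>D. finite D \<and> v = (\<lambda>k. \<Sum>d\<in>D. vhcomp s d v k)"
    by (intro ballI vec_sum_hcomp[of _ V n] submodule_vecs[OF sub] subsetD[OF B(1)])
  then obtain D where D: "\<And>v. v \<in> B \<Longrightarrow> finite (D v)"
    "\<And>v. v \<in> B \<Longrightarrow> v = (\<lambda>k. \<Sum>d\<in>D v. vhcomp s d v k)" by metis
  \<comment> \<open>The homogeneous components of the generators lie in \<open>N\<close>, which is
    graded, and their sums give the generators back.\<close>
  define C where "C = (\<Union>v\<in>B. (\<lambda>d. vhcomp s d v) ` D v)"
  have C: "C \<subseteq> N" "finite C"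
    unfolding C_def using B D(1) gr by auto
  have "v \<in> combinations V C" if "v \<in> B" for v
  proof -
    have "(\<lambda>k. \<Sum>d\<in>D v. vhcomp s d v k) \<in> combinations V C"
      using that by (intro combinations_sum combinations_self C) (auto simp: C_def)
    thus ?thesis using D(2)[OF that] by simp
  qed
  hence "combinations V B \<subseteq> combinations V C" by (rule combinations_trans)
  hence "combinations V C = N"
    using combinations_subset[OF sub C(1)] B(3) by blast
  moreover have "\<forall>g\<in>C. \<exists>d. homogeneous_vec s d g"
    by (auto simp: C_def)
  ultimately show ?thesis using C by (intro exI[of _ C]) auto
qed

text \<open>The map given by the matrix with rows \<open>g k\<close>. It is \<open>diff_map\<close>
  without the record and without the cut-off at the rank, which is automatic when the rows are
  vectors.\<close>

definition row_comb :: "nat \<Rightarrow> (nat \<Rightarrow> nat \<Rightarrow> ('v, 'k::field) mpoly) \<Rightarrow> (nat \<Rightarrow> ('v, 'k) mpoly)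
    \<Rightarrow> nat \<Rightarrow> ('v, 'k) mpoly" where
  "row_comb m g u = (\<lambda>l. \<Sum>k<m. u k * g k l)"

lemma row_comb_0 [simp]: "row_comb m g (\<lambda>_. 0) = (\<lambda>_. 0)"
  by (simp add: row_comb_def)

lemma row_comb_add: "row_comb m g (\<lambda>k. u k + v k) = (\<lambda>l. row_comb m g u l + row_comb m g v l)"
  by (simp add: row_comb_def sum.distrib distrib_right)

lemma row_comb_mult: "row_comb m g (\<lambda>k. a * v k) = (\<lambda>l. a * row_comb m g v l)"
  by (simp add: row_comb_def sum_distrib_left mult.assoc)

lemma vhcomp_row_comb:
  assumes "\<And>k. k < m \<Longrightarrow> homogeneous_vec s (t k) (g k)"
  shows "row_comb m g (vhcomp t d u) = vhcomp s d (row_comb m g u)"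
proof
  fix l
  have "hcomp (d - t k) (u k) * g k l = hcomp (d - s l) (u k * g k l)" if "k < m" for k
    using hcomp_mult[of "t k - s l" "g k l" "d - s l" "u k"] assms[OF that]
    by (simp add: homogeneous_vec_def)
  thus "row_comb m g (vhcomp t d u) l = vhcomp s d (row_comb m g u) l"
    by (simp add: row_comb_def vhcomp_def hcomp_sum)
qed

lemma graded_submodule_kernel:
  assumes "\<And>k. k < m \<Longrightarrow> homogeneous_vec s (t k) (g k)"
  shows "graded_submodule V m t {u \<in> vecs V m. row_comb m g u = (\<lambda>_. 0)}"
proof -
  have "row_comb m g (vhcomp t d u) = (\<lambda>_. 0)" if "row_comb m g u = (\<lambda>_. 0)" for d u
    by (simp add: vhcomp_row_comb[OF assms] that) (simp add: vhcomp_def)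
  thus ?thesis
    unfolding graded_submodule_def submodule_of_vecs_def
    by (auto simp: row_comb_add row_comb_mult)
qed

lemma hcomp_0_single: "hcomp 0 p = single 0 (lookup p 0)"
  by (rule poly_mapping_eqI)
     (auto simp: hcomp_def lookup_terms_with lookup_single when_def monom_degree_eq_0)

text \<open>A homogeneous generating set of least cardinality works. If a relation had a coefficient
  with nonzero constant term, its component in the degree of the corresponding generator would
  express that generator through the others.\<close>

lemma minimal_generators:
  fixes N :: "(nat \<Rightarrow> ('v, 'k::field) mpoly) set"
  assumes V: "finite V" and N: "graded_submodule V n s N"
  shows "\<exists>m t g. (\<forall>k<m. g k \<in> N \<and> homogeneous_vec s (t k) (g k)) \<and>
           row_comb m g ` vecs V m = N \<and>
           (\<forall>u\<in>vecs V m. row_comb m g u = (\<lambda>_. 0) \<longrightarrow> (\<forall>k. lookup (u k) 0 = 0))"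
proof -
  define gen where "gen B \<longleftrightarrow> B \<subseteq> N \<and> finite B \<and> combinations V B = N \<and>
    (\<forall>g\<in>B. \<exists>d. homogeneous_vec s d g)" for B
  obtain B where B: "gen B" and min: "\<And>C. gen C \<Longrightarrow> card B \<le> card C"
    using homogeneous_generators[OF V N] ex_has_least_nat[of gen _ card]
    unfolding gen_def by metis
  have fin: "finite B" using B by (simp add: gen_def)
  obtain g where "bij_betw g {0..<card B} B" using ex_bij_betw_nat_finite[OF fin] by blast
  hence inj: "inj_on g {..<card B}" and img: "g ` {..<card B} = B"
    by (auto simp: bij_betw_def atLeast0LessThan)
  let ?m = "card B"
  have gB: "g k \<in> B" if "k < ?m" for k using img that by blast
  have "\<forall>k. \<exists>d. k < ?m \<longrightarrow> homogeneous_vec s d (g k)"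
    using B gB unfolding gen_def by blast
  then obtain t where t: "\<And>k. k < ?m \<Longrightarrow> homogeneous_vec s (t k) (g k)" by metis
  have sumB: "(\<Sum>h\<in>B. \<phi> h) = (\<Sum>k<?m. \<phi> (g k))" for \<phi> :: "_ \<Rightarrow> ('v, 'k) mpoly"
    using sum.reindex[OF inj, of \<phi>] by (simp add: img)
  have comb: "row_comb ?m g u = (\<lambda>l. \<Sum>h\<in>B. u (the_inv_into {..<?m} g h) * h l)" for u
    using inj by (simp add: row_comb_def sumB the_inv_into_f_f)
  have "row_comb ?m g ` vecs V ?m = combinations V B"
  proof (intro equalityI subsetI)
    fix w assume "w \<in> row_comb ?m g ` vecs V ?m"
    then obtain u where u: "u \<in> vecs V ?m" "w = row_comb ?m g u" by blast
    show "w \<in> combinations V B"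
      unfolding combinations_def u(2) comb
      by (intro CollectI exI[of _ "\<lambda>h. u (the_inv_into {..<?m} g h)"]) (simp add: vecs_polys[OF u(1)])
  next
    fix w assume "w \<in> combinations V B"
    then obtain a where a: "w = (\<lambda>l. \<Sum>h\<in>B. a h * h l)" "\<forall>h\<in>B. a h \<in> polys V"
      by (auto simp: combinations_def)
    have "w = row_comb ?m g (\<lambda>k. if k < ?m then a (g k) else 0)"
      by (simp add: a(1) sumB row_comb_def)
    moreover have "(\<lambda>k. if k < ?m then a (g k) else 0) \<in> vecs V ?m"
      using a(2) gB by (auto simp: vecs_def)
    ultimately show "w \<in> row_comb ?m g ` vecs V ?m" by blast
  qed
  moreover have "lookup (u k0) 0 = 0"
    if u: "u \<in> vecs V ?m" "row_comb ?m g u = (\<lambda>_. 0)" for u k0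
  proof (rule ccontr)
    assume nz: "lookup (u k0) 0 \<noteq> 0"
    hence k0: "k0 < ?m" using u(1) by (cases "k0 < ?m") (auto simp: vecs_def)
    define c where "c = lookup (u k0) 0"
    \<comment> \<open>In degree \<open>t k0\<close> the coefficient of \<open>g k0\<close> has
      degree 0, so it is the scalar \<open>c\<close>.\<close>
    define w where "w = vhcomp t (t k0) u"
    have w: "w \<in> vecs V ?m" "row_comb ?m g w = (\<lambda>_. 0)"
      using graded_submodule_kernel[of ?m s t g V, OF t] u
      unfolding w_def graded_submodule_def by blast+
    have wk0: "w k0 = single 0 c"
      by (simp add: w_def vhcomp_def hcomp_0_single c_def)
    define b where "b = single (0 :: 'v \<Rightarrow>\<^sub>0 nat) (- 1 / c)"
    have b: "b \<in> polys V" "b * w k0 = - 1"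
      using nz by (auto simp: b_def wk0 mult_single c_def simp flip: single_one single_uminus)
    have "g k0 l = (\<Sum>k\<in>{..<?m} - {k0}. (b * w k) * g k l)" for l
    proof -
      have "0 = b * row_comb ?m g w l" by (simp add: w(2))
      also have "\<dots> = b * w k0 * g k0 l + (\<Sum>k\<in>{..<?m} - {k0}. b * w k * g k l)"
        using k0 by (simp add: row_comb_def distrib_left sum_distrib_left mult.assoc sum.remove[of _ k0])
      finally show ?thesis by (simp add: b(2))
    qed
    hence eq: "g k0 = (\<lambda>l. \<Sum>k\<in>{..<?m} - {k0}. (b * w k) * g k l)" by blast
    have "(\<lambda>l. \<Sum>k\<in>{..<?m} - {k0}. (b * w k) * g k l) \<in> combinations V (B - {g k0})"
    proof (intro combinations_sum combinations_mult combinations_self)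
      show "b * w k \<in> polys V" for k using b(1) vecs_polys[OF w(1)] by blast
      show "g k \<in> B - {g k0}" if "k \<in> {..<?m} - {k0}" for k
        using that gB inj k0 by (auto simp: inj_on_def)
    qed (use fin in auto)
    hence "g k0 \<in> combinations V (B - {g k0})" using eq by metis
    hence "h \<in> combinations V (B - {g k0})" if "h \<in> B" for h
      using that fin by (cases "h = g k0") (auto intro: combinations_self)
    hence "combinations V B \<subseteq> combinations V (B - {g k0})" by (rule combinations_trans)
    moreover have "combinations V (B - {g k0}) \<subseteq> N"
      using B N by (intro combinations_subset[of V n]) (auto simp: gen_def graded_submodule_def)
    ultimately have "gen (B - {g k0})" using B by (auto simp: gen_def)
    from min[OF this] show False
      using gB[OF k0] fin card_Diff1_less[of B "g k0"] by simp
  qed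
  ultimately show ?thesis
    using gB t B unfolding gen_def by (intro exI[of _ ?m] exI[of _ t] exI[of _ g]) blast
qed

text \<open>\<open>graded_free_resolution\<close> stripped of the module: only the kernel
  \<open>N\<close> of the augmentation remains, so that \<open>F\<close> resolves its free module in
  step 0 modulo \<open>N\<close>.\<close>

definition resolves ::
  "'v set \<Rightarrow> (('v, 'k::field) mpoly, 'm) free_res \<Rightarrow> (nat \<Rightarrow> ('v, 'k) mpoly) set \<Rightarrow> bool" where
  "resolves V F N \<longleftrightarrow>
     (\<forall>i. \<forall>k<rank F (Suc i). \<forall>l<rank F i. diff F i k l \<in> polys V \<and>
        homogeneous (shift F (Suc i) k - shift F i l) (diff F i k l)) \<and>
     diff_map F 0 ` vecs V (rank F 1) = N \<and>
     (\<forall>i. {v \<in> vecs V (rank F (Suc i)). diff_map F i v = (\<lambda>_. 0)} =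
          diff_map F (Suc i) ` vecs V (rank F (Suc (Suc i))))"

definition minimal_diffs :: "(('v, 'k::field) mpoly, 'm) free_res \<Rightarrow> bool" where
  "minimal_diffs F \<longleftrightarrow>
     (\<forall>i. \<forall>k<rank F (Suc i). \<forall>l<rank F i. lookup (diff F i k l) 0 = 0)"

text \<open>Repeated passage to the relations among minimal generators. \<open>N0\<close> keeps
  constant terms out of the first matrix; the later matrices inherit this from
  \<open>minimal_generators\<close>.\<close>

theorem ex_minimal_resolution:
  fixes N :: "(nat \<Rightarrow> ('v, 'k::field) mpoly) set"
  assumes V: "finite V" and N: "graded_submodule V n s N"
    and N0: "\<And>u k. u \<in> N \<Longrightarrow> lookup (u k) 0 = 0"
  shows "\<exists>F :: (('v, 'k) mpoly, 'm) free_res.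
           rank F 0 = n \<and> shift F 0 = s \<and> aug F = a \<and> resolves V F N \<and> minimal_diffs F"
proof -
  define P where "P x \<longleftrightarrow> (case x of (n, s, N) \<Rightarrow> graded_submodule V n s N \<and>
      (\<forall>u\<in>N. \<forall>k. lookup (u k) 0 = 0))"
    for x :: "nat \<times> (nat \<Rightarrow> int) \<times> (nat \<Rightarrow> ('v, 'k) mpoly) set"
  define R where "R x y g \<longleftrightarrow> (case (x, y) of ((n, s, N), (m, t, K)) \<Rightarrow>
      (\<forall>k<m. g k \<in> N \<and> homogeneous_vec s (t k) (g k)) \<and> row_comb m g ` vecs V m = N \<and>
      K = {u \<in> vecs V m. row_comb m g u = (\<lambda>_. 0)})"
    for x y :: "nat \<times> (nat \<Rightarrow> int) \<times> (nat \<Rightarrow> ('v, 'k) mpoly) set" and g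
  have step: "\<exists>y. P y \<and> (\<exists>g. R x y g)" if "P x" for x
  proof -
    obtain n s N where x: "x = (n, s, N)" by (cases x)
    have N: "graded_submodule V n s N" using that by (simp add: P_def x)
    obtain m t g where g: "\<forall>k<m. g k \<in> N \<and> homogeneous_vec s (t k) (g k)"
      "row_comb m g ` vecs V m = N"
      "\<forall>u\<in>vecs V m. row_comb m g u = (\<lambda>_. 0) \<longrightarrow> (\<forall>k. lookup (u k) 0 = 0)"
      using minimal_generators[OF V N] by (elim exE conjE)
    have "graded_submodule V m t {u \<in> vecs V m. row_comb m g u = (\<lambda>_. 0)}"
      using g(1) by (intro graded_submodule_kernel) blast
    thus ?thesis
      using g by (intro exI[of _ "(m, t, {u \<in> vecs V m. row_comb m g u = (\<lambda>_. 0)})"])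
        (auto simp: P_def R_def x)
  qed
  \<comment> \<open>A state consists of the rank, the degrees and the submodule still to be
    resolved; the matrices between consecutive states are selected afterwards.\<close>
  have "\<exists>f. \<forall>i. (P (f i) \<and> (i = 0 \<longrightarrow> f i = (n, s, N))) \<and> (\<exists>g. R (f i) (f (Suc i)) g)"
  proof (rule dependent_nat_choice)
    show "\<exists>x. P x \<and> (0 = 0 \<longrightarrow> x = (n, s, N))" using N N0 by (auto simp: P_def)
    show "\<exists>y. (P y \<and> (Suc i = 0 \<longrightarrow> y = (n, s, N))) \<and> (\<exists>g. R x y g)"
      if "P x \<and> (i = 0 \<longrightarrow> x = (n, s, N))" for x i
      using step that by auto
  qed
  then obtain f where f: "\<And>i. P (f i)" "f 0 = (n, s, N)" "\<And>i. \<exists>g. R (f i) (f (Suc i)) g" by blast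
  obtain g where g: "\<And>i. R (f i) (f (Suc i)) (g i)" using f(3) by metis
  define rk sh M where "rk i = fst (f i)" and "sh i = fst (snd (f i))" and "M i = snd (snd (f i))" for i
  have fi: "f i = (rk i, sh i, M i)" for i by (simp add: rk_def sh_def M_def)
  have PM: "graded_submodule V (rk i) (sh i) (M i)" "\<And>u k. u \<in> M i \<Longrightarrow> lookup (u k) 0 = 0" for i
    using f(1)[of i] by (auto simp: P_def fi)
  have Rg: "\<And>k. k < rk (Suc i) \<Longrightarrow> g i k \<in> M i"
    "\<And>k. k < rk (Suc i) \<Longrightarrow> homogeneous_vec (sh i) (sh (Suc i) k) (g i k)"
    "row_comb (rk (Suc i)) (g i) ` vecs V (rk (Suc i)) = M i"
    "M (Suc i) = {u \<in> vecs V (rk (Suc i)). row_comb (rk (Suc i)) (g i) u = (\<lambda>_. 0)}" for i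
    using g[of i] by (auto simp: R_def fi)
  have gv: "g i k \<in> vecs V (rk i)" if "k < rk (Suc i)" for i k
    using Rg(1)[OF that] PM(1)[of i] by (auto simp: graded_submodule_def submodule_of_vecs_def)
  define F :: "(('v, 'k) mpoly, 'm) free_res"
    where "F = \<lparr>rank = rk, shift = sh, diff = g, aug = a\<rparr>"
  have dm: "diff_map F i u = row_comb (rk (Suc i)) (g i) u" for i u
    unfolding diff_map_def row_comb_def F_def using gv[of _ i] by (auto simp: fun_eq_iff vecs_def)
  have "resolves V F N"
    unfolding resolves_def
  proof (intro conjI allI impI)
    fix i k l assume kl: "k < rank F (Suc i)" "l < rank F i"
    have "g i k l \<in> polys V" using kl(1) by (intro vecs_polys[OF gv]) (simp add: F_def)
    thus "diff F i k l \<in> polys V" by (simp add: F_def)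
    show "homogeneous (shift F (Suc i) k - shift F i l) (diff F i k l)"
      using Rg(2)[of k i] kl by (simp add: F_def homogeneous_vec_def)
  next
    show "diff_map F 0 ` vecs V (rank F 1) = N"
      using Rg(3)[of 0] f(2) unfolding dm by (simp add: F_def fi)
    show "{v \<in> vecs V (rank F (Suc i)). diff_map F i v = (\<lambda>_. 0)} =
      diff_map F (Suc i) ` vecs V (rank F (Suc (Suc i)))" for i
      using Rg(3)[of "Suc i"] Rg(4)[of i] unfolding dm by (simp add: F_def)
  qed
  moreover have "minimal_diffs F"
    unfolding minimal_diffs_def using PM(2)[OF Rg(1)] by (simp add: F_def)
  ultimately show ?thesis
    using f(2) by (intro exI[of _ F]) (auto simp: F_def fi)
qed


section \<open>Homology of a resolution modulo an ideal\<close>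

lemma diff_map_beyond: "l \<ge> rank F i \<Longrightarrow> diff_map F i v l = 0"
  by (simp add: diff_map_def)

lemma diff_map_0 [simp]: "diff_map F i (\<lambda>_. 0) = (\<lambda>_. 0)"
  by (simp add: diff_map_def fun_eq_iff)

lemma diff_map_add: "diff_map F i (\<lambda>k. u k + v k) = (\<lambda>l. diff_map F i u l + diff_map F i v l)"
  by (simp add: diff_map_def sum.distrib distrib_right fun_eq_iff)

lemma diff_map_diff: "diff_map F i (\<lambda>k. u k - v k) = (\<lambda>l. diff_map F i u l - diff_map F i v l)"
  by (simp add: diff_map_def sum_subtractf left_diff_distrib fun_eq_iff)

lemma diff_map_mult: "diff_map F i (\<lambda>k. a * v k) = (\<lambda>l. a * diff_map F i v l)"
  by (simp add: diff_map_def sum_distrib_left mult.assoc fun_eq_iff)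

lemma diff_map_sum: "diff_map F i (\<lambda>k. \<Sum>x\<in>A. f x k) = (\<lambda>l. \<Sum>x\<in>A. diff_map F i (f x) l)"
  by (induction A rule: infinite_finite_induct) (simp_all add: diff_map_add)

text \<open>The array \<open>c\<close> is an element of a tensor product of two free modules. The
  two differentials act on different indices, as in a double complex, and commute by exchanging the
  sums.\<close>

lemma diff_map_commute:
  "diff_map F i (\<lambda>k. diff_map P q (c k) l) k' = diff_map P q (\<lambda>l'. diff_map F i (\<lambda>k. c k l') k') l"
proof (cases "l < rank P q \<and> k' < rank F i")
  case True
  thus ?thesis
    by (simp add: diff_map_def sum_distrib_right mult.assoc mult.commute[of "diff P q _ l"])
       (rule sum.swap)
qed (auto simp: diff_map_def)

lemma vecsI: "(\<And>k. v k \<in> polys V) \<Longrightarrow> (\<And>k. k \<ge> n \<Longrightarrow> v k = 0) \<Longrightarrow> v \<in> vecs V n"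
  by (simp add: vecs_def)

context
  fixes V and F :: "(('v, 'k::field) mpoly, 'm) free_res" and N
  assumes F: "resolves V F N"
begin

lemma diff_in_polys: "k < rank F (Suc i) \<Longrightarrow> l < rank F i \<Longrightarrow> diff F i k l \<in> polys V"
  and diff_homogeneous: "k < rank F (Suc i) \<Longrightarrow> l < rank F i \<Longrightarrow>
        homogeneous (shift F (Suc i) k - shift F i l) (diff F i k l)"
  and diff_map_0_image: "diff_map F 0 ` vecs V (rank F (Suc 0)) = N"
  and diff_map_exact: "{v \<in> vecs V (rank F (Suc i)). diff_map F i v = (\<lambda>_. 0)} =
          diff_map F (Suc i) ` vecs V (rank F (Suc (Suc i)))"
  using F by (auto simp: resolves_def)

lemma diff_map_in_vecs: "v \<in> vecs V (rank F (Suc i)) \<Longrightarrow> diff_map F i v \<in> vecs V (rank F i)"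
  using diff_in_polys vecs_polys[of v V "rank F (Suc i)"]
  by (auto simp: diff_map_def intro!: vecsI polys_sum polys_mult)

lemma diff_map_diff_map: "v \<in> vecs V (rank F (Suc (Suc i))) \<Longrightarrow> diff_map F i (diff_map F (Suc i) v) = (\<lambda>_. 0)"
  using diff_map_exact[of i] by blast

lemma vhcomp_diff_map:
  "diff_map F i (vhcomp (shift F (Suc i)) d v) = vhcomp (shift F i) d (diff_map F i v)"
proof
  fix l
  have "hcomp (d - shift F (Suc i) k) (v k) * diff F i k l = hcomp (d - shift F i l) (v k * diff F i k l)"
    if "k < rank F (Suc i)" "l < rank F i" for k
    using hcomp_mult[OF diff_homogeneous[OF that], of "d - shift F i l" "v k"] by simp
  thus "diff_map F i (vhcomp (shift F (Suc i)) d v) l = vhcomp (shift F i) d (diff_map F i v) l"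
    by (simp add: diff_map_def vhcomp_def hcomp_sum)
qed

lemma homogeneous_diff_map:
  "homogeneous_vec (shift F (Suc i)) d v \<Longrightarrow> homogeneous_vec (shift F i) d (diff_map F i v)"
  by (metis vhcomp_diff_map vhcomp_homogeneous homogeneous_vhcomp)

end

section \<open>Ideals of S and the homology of a resolution modulo an ideal\<close>

definition poly_ideal :: "'v set \<Rightarrow> ('v, 'k::field) mpoly set \<Rightarrow> bool" where
  "poly_ideal V I \<longleftrightarrow> I \<subseteq> polys V \<and> 0 \<in> I \<and> (\<forall>p\<in>I. \<forall>q\<in>I. p + q \<in> I) \<and>
     (\<forall>a\<in>polys V. \<forall>p\<in>I. a * p \<in> I)"

lemma
  assumes "poly_ideal V I"
  shows ideal_polys: "p \<in> I \<Longrightarrow> p \<in> polys V"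
    and ideal_0: "0 \<in> I"
    and ideal_add: "p \<in> I \<Longrightarrow> q \<in> I \<Longrightarrow> p + q \<in> I"
    and ideal_mult: "a \<in> polys V \<Longrightarrow> p \<in> I \<Longrightarrow> a * p \<in> I"
  using assms unfolding poly_ideal_def by blast+

lemma ideal_uminus:
  assumes "poly_ideal V I" "p \<in> I"
  shows "- p \<in> I"
  using ideal_mult[OF assms(1) _ assms(2), of "- 1"] by (simp add: polys_uminus)

lemma ideal_diff:
  assumes "poly_ideal V I" "p \<in> I" "q \<in> I"
  shows "p - q \<in> I"
  using ideal_add[OF assms(1,2) ideal_uminus[OF assms(1,3)]] by simp

lemma ideal_sum:
  assumes "poly_ideal V I" "\<And>x. x \<in> A \<Longrightarrow> f x \<in> I"
  shows "(\<Sum>x\<in>A. f x) \<in> I"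
  using assms(2)
  by (induction A rule: infinite_finite_induct) (auto intro: ideal_add[OF assms(1)] ideal_0[OF assms(1)])

lemma diff_map_in_ideal:
  assumes "resolves V F N" "poly_ideal V I" "\<And>k. v k \<in> I"
  shows "diff_map F i v l \<in> I"
  using ideal_mult[OF assms(2) diff_in_polys[OF assms(1)] assms(3)] ideal_0[OF assms(2)]
  by (auto simp: diff_map_def mult.commute intro!: ideal_sum[OF assms(2)])

text \<open>For a resolution \<open>P\<close> of the residue field this says \<open>Tor\<^sub>i(K, S/I)\<^sub>j = 0\<close>.\<close>
definition tor_vanishes ::
  "'v set \<Rightarrow> (('v, 'k::field) mpoly, 'm) free_res \<Rightarrow> ('v, 'k) mpoly set \<Rightarrow> nat \<Rightarrow> int \<Rightarrow> bool" where
  "tor_vanishes V P I i j \<longleftrightarrow>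
     (\<forall>c\<in>vecs V (rank P i). homogeneous_vec (shift P i) j c \<longrightarrow>
        (\<forall>i' l. i = Suc i' \<longrightarrow> diff_map P i' c l \<in> I) \<longrightarrow>
        (\<exists>b\<in>vecs V (rank P (Suc i)). \<forall>l. c l - diff_map P i b l \<in> I))"

text \<open>The same for the quotient of a free module with \<open>n\<close> basis elements of degrees \<open>s\<close> by the
  submodule \<open>N\<close>.\<close>
definition tor_vanishes_mod ::
  "'v set \<Rightarrow> (('v, 'k::field) mpoly, 'm) free_res \<Rightarrow> nat \<Rightarrow> (nat \<Rightarrow> int) \<Rightarrow>
     (nat \<Rightarrow> ('v, 'k) mpoly) set \<Rightarrow> nat \<Rightarrow> int \<Rightarrow> bool" where
  "tor_vanishes_mod V P n s N i j \<longleftrightarrow>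
     (\<forall>c. (\<forall>k. c k \<in> vecs V (rank P i)) \<longrightarrow> (\<forall>k\<ge>n. c k = (\<lambda>_. 0)) \<longrightarrow>
        (\<forall>k. homogeneous_vec (shift P i) (j - s k) (c k)) \<longrightarrow>
        (\<forall>i' l. i = Suc i' \<longrightarrow> (\<lambda>k. diff_map P i' (c k) l) \<in> N) \<longrightarrow>
        (\<exists>b. (\<forall>k. b k \<in> vecs V (rank P (Suc i))) \<and> (\<forall>k\<ge>n. b k = (\<lambda>_. 0)) \<and>
           (\<forall>l. (\<lambda>k. c k l - diff_map P i (b k) l) \<in> N)))"


section \<open>Monomial ideals\<close>

text \<open>Describing the ideal by a predicate on exponents makes ideal operations explicit: for
  upward closed \<open>A\<close>, the colon ideal by the variable \<open>v\<close> belongs to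
  \<open>\<lambda>m. A (single v 1 + m)\<close>, and adjoining the variable gives
  \<open>\<lambda>m. A m \<or> 0 < lookup m v\<close>.\<close>

definition monomial_ideal :: "'v set \<Rightarrow> (('v \<Rightarrow>\<^sub>0 nat) \<Rightarrow> bool) \<Rightarrow> ('v, 'k::field) mpoly set" where
  "monomial_ideal V A = {p \<in> polys V. \<forall>m\<in>keys p. A m}"

definition up_closed :: "(('v \<Rightarrow>\<^sub>0 nat) \<Rightarrow> bool) \<Rightarrow> bool" where
  "up_closed A \<longleftrightarrow> (\<forall>m m'. A m \<longrightarrow> A (m' + m))"

lemma monomial_ideal_ideal:
  assumes "up_closed A"
  shows "poly_ideal V (monomial_ideal V A :: ('v, 'k::field) mpoly set)"
  unfolding poly_ideal_def
proof (intro conjI ballI)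
  fix p q :: "('v, 'k) mpoly" assume "p \<in> monomial_ideal V A" "q \<in> monomial_ideal V A"
  thus "p + q \<in> monomial_ideal V A"
    using keys_add[of p q] by (auto simp: monomial_ideal_def)
next
  fix a p :: "('v, 'k) mpoly" assume "a \<in> polys V" "p \<in> monomial_ideal V A"
  thus "a * p \<in> monomial_ideal V A"
    using keys_mult[of a p] assms unfolding monomial_ideal_def up_closed_def by fast
qed (auto simp: monomial_ideal_def)

lemma hcomp_monomial_ideal: "p \<in> monomial_ideal V A \<Longrightarrow> hcomp d p \<in> monomial_ideal V A"
  unfolding monomial_ideal_def hcomp_def by (auto simp: keys_terms_with)

lemma monomial_ideal_mono: "(\<And>m. A m \<Longrightarrow> B m) \<Longrightarrow> monomial_ideal V A \<subseteq> monomial_ideal V B"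
  by (auto simp: monomial_ideal_def)

section \<open>Colon ideals, adjoined variables and their exact sequences\<close>

lemma var_in_polys: "v \<in> V \<Longrightarrow> var v \<in> polys V"
  unfolding var_def by (intro polys_single) simp

lemma homogeneous_var [simp]: "homogeneous 1 (var v)"
  by (simp add: homogeneous_def var_def)

lemma monom_split: "lookup m v > 0 \<Longrightarrow> m = single v 1 + (m - single v (1 :: nat))"
  by (rule poly_mapping_eqI) (auto simp: lookup_add lookup_minus lookup_single when_def)

lemma lookup_var_mult_add: "lookup (var v * a) (single v 1 + m) = lookup (a :: ('v, 'k::field) mpoly) m"
  by (simp add: var_def lookup_single_mult_add del: One_nat_def)

lemma var_mult_monomial_ideal:
  assumes "v \<in> V" "y \<in> monomial_ideal V (\<lambda>m. A (single v 1 + m))"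
  shows "var v * y \<in> monomial_ideal V A"
  using assms keys_single_mult[of "single v 1" 1 y] polys_mult[OF var_in_polys[OF assms(1)]]
  by (auto simp: monomial_ideal_def var_def)

text \<open>Together with \<open>var_mult_monomial_ideal\<close> this describes the colon ideal of
  \<open>monomial_ideal V A\<close> by \<open>var v\<close>.\<close>

lemma var_mult_monomial_idealD:
  assumes "var v * a \<in> monomial_ideal V A" "a \<in> polys V"
  shows "a \<in> monomial_ideal V (\<lambda>m. A (single v 1 + m))"
proof -
  have "single v 1 + m \<in> keys (var v * a)" if "m \<in> keys a" for m
    using that by (simp only: in_keys_iff lookup_var_mult_add) simp
  thus ?thesis using assms by (auto simp: monomial_ideal_def)
qed

lemma divisible_by_var:
  assumes "p \<in> polys V" "\<forall>m\<in>keys p. 0 < lookup m v" "homogeneous d p"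
  shows "\<exists>a\<in>polys V. homogeneous (d - 1) a \<and> p = var v * (a :: ('v, 'k::field) mpoly)"
proof -
  define a where "a = Poly_Mapping.map_key (\<lambda>m. single v 1 + m) p"
  have inj: "inj (\<lambda>m. single v (1 :: nat) + m)" by (auto simp: inj_def)
  have la: "lookup a m = lookup p (single v 1 + m)" for m
    unfolding a_def using inj by (simp add: map_key.rep_eq)
  have ka: "single v 1 + m \<in> keys p" if "m \<in> keys a" for m
    using that by (simp add: in_keys_iff la)
  have "a \<in> polys V"
    using assms(1) ka by (fastforce simp: polys_def keys_add_nat)
  moreover have "homogeneous (d - 1) a"
    unfolding homogeneous_def
  proof
    fix m assume "m \<in> keys a"
    hence "int (monom_degree (single v 1 + m)) = d" using ka assms(3) unfolding homogeneous_def by blast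
    thus "int (monom_degree m) = d - 1" by (simp add: monom_degree_add)
  qed
  moreover have "p = var v * a"
  proof (rule poly_mapping_eqI)
    fix m show "lookup p m = lookup (var v * a) m"
    proof (cases "lookup m v > 0")
      case True
      thus ?thesis using monom_split[OF True] la lookup_var_mult_add by metis
    next
      case False
      hence "m \<notin> keys (var v * a)"
        using keys_single_mult[of "single v 1" 1 a] by (auto simp: var_def lookup_add)
      moreover have "m \<notin> keys p" using False bspec[OF assms(2)] by (metis (lifting))
      ultimately show ?thesis by (simp add: in_keys_iff)
    qed
  qed
  ultimately show ?thesis by blast
qed

text \<open>Every term of \<open>p\<close> outside \<open>A\<close> is divisible by the variable, so
  these terms together form the multiple of \<open>var v\<close>.\<close>

lemma monomial_ideal_insert_split:
  assumes "p \<in> monomial_ideal V (\<lambda>m. A m \<or> 0 < lookup m v)" "homogeneous d p"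
  shows "\<exists>y\<in>monomial_ideal V A. \<exists>a\<in>polys V. homogeneous (d - 1) a \<and> p = y + var v * (a :: ('v, 'k::field) mpoly)"
proof -
  let ?q = "terms_with (\<lambda>m. \<not> A m) p"
  have "\<exists>a\<in>polys V. homogeneous (d - 1) a \<and> ?q = var v * a"
    using assms by (intro divisible_by_var) (auto simp: monomial_ideal_def keys_terms_with homogeneous_def)
  moreover have "terms_with A p \<in> monomial_ideal V A"
    using assms by (auto simp: monomial_ideal_def keys_terms_with)
  ultimately show ?thesis using terms_with_split[of p A] by metis
qed

lemma vec_insert_split:
  fixes c :: "nat \<Rightarrow> ('v, 'k::field) mpoly"
  assumes "c \<in> vecs V n" "homogeneous_vec s d c"
    "\<And>l. c l \<in> monomial_ideal V (\<lambda>m. A m \<or> 0 < lookup m v)" "up_closed A"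
  shows "\<exists>y a. a \<in> vecs V n \<and> y \<in> vecs V n \<and> homogeneous_vec s (d - 1) a \<and>
           (\<forall>l. y l \<in> monomial_ideal V A) \<and> c = (\<lambda>l. y l + var v * a l)"
proof -
  have "\<exists>y\<in>monomial_ideal V A. \<exists>a\<in>polys V. homogeneous (d - s l - 1) a \<and> c l = y + var v * a" for l
    using assms(2,3) by (intro monomial_ideal_insert_split) (auto simp: homogeneous_vec_def)
  then obtain y a where ya: "\<And>l. y l \<in> monomial_ideal V A" "\<And>l. a l \<in> polys V"
    "\<And>l. homogeneous (d - s l - 1) (a l)" "\<And>l. c l = y l + var v * a l" by metis
  \<comment> \<open>The pieces were chosen entry by entry; cutting them off at \<open>n\<close>
    makes them vectors of the free module.\<close>
  define y' a' where "y' = (\<lambda>l. if l < n then y l else 0)" and "a' = (\<lambda>l. if l < n then a l else 0)"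
  have "a' \<in> vecs V n" "y' \<in> vecs V n"
    using ya(1,2) by (auto simp: a'_def y'_def vecs_def monomial_ideal_def)
  moreover have "homogeneous_vec s (d - 1) a'"
    using ya(3) by (auto simp: homogeneous_vec_def a'_def algebra_simps)
  moreover have "\<forall>l. y' l \<in> monomial_ideal V A"
    using ya(1) by (auto simp: y'_def monomial_ideal_def)
  moreover have "c = (\<lambda>l. y' l + var v * a' l)"
    using assms(1) ya(4) by (auto simp: fun_eq_iff y'_def a'_def vecs_def)
  ultimately show ?thesis by blast
qed

lemma up_closed_insert: "up_closed A \<Longrightarrow> up_closed (\<lambda>m. A m \<or> 0 < lookup m v)"
  by (auto simp: up_closed_def lookup_add)

text \<open>Half-exactness of \<open>Tor\<close> on \<open>0 \<rightarrow> S/(I : x\<^sub>v)(-1) \<rightarrow> S/I \<rightarrow> S/(I, x\<^sub>v) \<rightarrow> 0\<close>.\<close>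
lemma tor_vanishes_colon:
  fixes P :: "(('v, 'k::field) mpoly, 'm) free_res"
  assumes P: "resolves V P N" and A: "up_closed A" and v: "v \<in> V"
    and colon: "tor_vanishes V P (monomial_ideal V (\<lambda>m. A (single v 1 + m))) i (j - 1)"
    and ins: "tor_vanishes V P (monomial_ideal V (\<lambda>m. A m \<or> 0 < lookup m v)) i j"
  shows "tor_vanishes V P (monomial_ideal V A) i j"
  unfolding tor_vanishes_def
proof (intro ballI impI)
  fix c assume c: "c \<in> vecs V (rank P i)" "homogeneous_vec (shift P i) j c"
    and cyc: "\<forall>i' l. i = Suc i' \<longrightarrow> diff_map P i' c l \<in> monomial_ideal V A"
  note I = monomial_ideal_ideal[OF A]
  note x = var_in_polys[OF v]
  let ?d = "diff_map P i" and ?B = "\<lambda>m. A m \<or> 0 < lookup m v"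
  have "diff_map P i' c l \<in> monomial_ideal V ?B" if "i = Suc i'" for i' l
    using cyc that monomial_ideal_mono[of A ?B] by blast
  then obtain b0 where b0: "b0 \<in> vecs V (rank P (Suc i))"
    "\<And>l. c l - ?d b0 l \<in> monomial_ideal V ?B"
    using ins c unfolding tor_vanishes_def by blast
  \<comment> \<open>Passing to the part of degree \<open>j\<close> keeps the remainder
    \<open>c - ?d b\<close> homogeneous, as its splitting into \<open>y\<close> and a multiple of
    \<open>var v\<close> requires.\<close>
  define b where "b = vhcomp (shift P (Suc i)) j b0"
  have b: "b \<in> vecs V (rank P (Suc i))" using b0(1) by (auto simp: b_def)
  have eq: "(\<lambda>l. c l - ?d b l) = vhcomp (shift P i) j (\<lambda>l. c l - ?d b0 l)"
    unfolding b_def vhcomp_diff_map[OF P] vhcomp_diff vhcomp_homogeneous[OF c(2)] ..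
  have "\<exists>y a. a \<in> vecs V (rank P i) \<and> y \<in> vecs V (rank P i) \<and> homogeneous_vec (shift P i) (j - 1) a \<and>
      (\<forall>l. y l \<in> monomial_ideal V A) \<and> (\<lambda>l. c l - ?d b l) = (\<lambda>l. y l + var v * a l)"
  proof (rule vec_insert_split[OF _ _ _ A])
    show "(\<lambda>l. c l - ?d b l) \<in> vecs V (rank P i)"
      by (intro vec_diff c diff_map_in_vecs[OF P] b)
    show "homogeneous_vec (shift P i) j (\<lambda>l. c l - ?d b l)"
      unfolding eq by simp
    show "c l - ?d b l \<in> monomial_ideal V ?B" for l
      using hcomp_monomial_ideal[OF b0(2)[of l]] fun_cong[OF eq, of l] by (simp add: vhcomp_def)
  qed
  then obtain y a where a: "a \<in> vecs V (rank P i)" "homogeneous_vec (shift P i) (j - 1) a"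
    and y: "y \<in> vecs V (rank P i)" "\<And>l. y l \<in> monomial_ideal V A"
    and cya: "(\<lambda>l. c l - ?d b l) = (\<lambda>l. y l + var v * a l)" by blast
  \<comment> \<open>Applying the differential to \<open>c - ?d b = y + var v * a\<close> removes
    \<open>b\<close>, so \<open>var v\<close> times the boundary of \<open>a\<close> lies in the
    ideal: \<open>a\<close> is a cycle modulo the colon ideal.\<close>
  have "diff_map P i' a l \<in> monomial_ideal V (\<lambda>m. A (single v 1 + m))" if i: "i = Suc i'" for i' l
  proof (rule var_mult_monomial_idealD)
    show "diff_map P i' a l \<in> polys V"
      using a(1) i by (intro vecs_polys[OF diff_map_in_vecs[OF P]]) simp
    have "diff_map P i' (?d b) l = 0"
      using diff_map_diff_map[OF P] b i by simp
    hence "diff_map P i' c l = diff_map P i' y l + var v * diff_map P i' a l"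
      using arg_cong[OF cya, of "\<lambda>f. diff_map P i' f l"]
      by (simp add: diff_map_diff diff_map_add diff_map_mult)
    hence "var v * diff_map P i' a l = diff_map P i' c l - diff_map P i' y l" by simp
    thus "var v * diff_map P i' a l \<in> monomial_ideal V A"
      using cyc i diff_map_in_ideal[OF P I y(2)] by (auto intro: ideal_diff[OF I])
  qed
  then obtain b' where b': "b' \<in> vecs V (rank P (Suc i))"
    "\<And>l. a l - ?d b' l \<in> monomial_ideal V (\<lambda>m. A (single v 1 + m))"
    using colon a unfolding tor_vanishes_def by blast
  show "\<exists>b\<in>vecs V (rank P (Suc i)). \<forall>l. c l - ?d b l \<in> monomial_ideal V A"
  proof (intro bexI allI)
    show "(\<lambda>k. b k + var v * b' k) \<in> vecs V (rank P (Suc i))"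
      by (intro vec_add b vec_mult x b')
    fix l
    have "c l - ?d (\<lambda>k. b k + var v * b' k) l = y l + var v * (a l - ?d b' l)"
      using fun_cong[OF cya, of l] by (simp add: diff_map_add diff_map_mult algebra_simps)
    thus "c l - ?d (\<lambda>k. b k + var v * b' k) l \<in> monomial_ideal V A"
      using ideal_add[OF I y(2) var_mult_monomial_ideal[OF v b'(2)]] by simp
  qed
qed

text \<open>The connecting homomorphism of \<open>0 \<rightarrow> S/I(-1) \<rightarrow> S/I \<rightarrow> S/(I, x\<^sub>v) \<rightarrow> 0\<close> for
  a non-zero-divisor \<open>x\<^sub>v\<close> on \<open>S/I\<close>.\<close>
lemma tor_vanishes_insert:
  fixes P :: "(('v, 'k::field) mpoly, 'm) free_res"
  assumes P: "resolves V P N" and A: "up_closed A" and v: "v \<in> V"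
    and reg: "\<And>m. A (single v 1 + m) \<longleftrightarrow> A m"
    and T: "tor_vanishes V P (monomial_ideal V A) i j"
    and T': "\<And>i'. i = Suc i' \<Longrightarrow> tor_vanishes V P (monomial_ideal V A) i' (j - 1)"
  shows "tor_vanishes V P (monomial_ideal V (\<lambda>m. A m \<or> 0 < lookup m v)) i j"
  unfolding tor_vanishes_def
proof (intro ballI impI)
  let ?B = "\<lambda>m. A m \<or> 0 < lookup m v"
  fix c assume c: "c \<in> vecs V (rank P i)" "homogeneous_vec (shift P i) j c"
    and cyc: "\<forall>i' l. i = Suc i' \<longrightarrow> diff_map P i' c l \<in> monomial_ideal V ?B"
  note I = monomial_ideal_ideal[OF A] and I' = monomial_ideal_ideal[OF up_closed_insert[OF A]]
  note x = var_in_polys[OF v]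
  have AB: "monomial_ideal V A \<subseteq> (monomial_ideal V ?B :: ('v, 'k) mpoly set)"
    by (rule monomial_ideal_mono) simp
  have xB: "var v * p \<in> monomial_ideal V ?B" if "p \<in> polys V" for p :: "('v, 'k) mpoly"
    using that by (intro var_mult_monomial_ideal v) (auto simp: monomial_ideal_def lookup_add)
  show "\<exists>b\<in>vecs V (rank P (Suc i)). \<forall>l. c l - diff_map P i b l \<in> monomial_ideal V ?B"
  proof (cases i)
    \<comment> \<open>In homological degree 0 there is no cycle condition, so a solution modulo the
      smaller ideal is also one modulo the larger.\<close>
    case 0
    thus ?thesis using T c AB unfolding tor_vanishes_def by blast
  next
    case (Suc i')
    let ?d = "diff_map P i'"
    have "\<exists>y a. a \<in> vecs V (rank P i') \<and> y \<in> vecs V (rank P i') \<and> homogeneous_vec (shift P i') (j - 1) a \<and>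
        (\<forall>l. y l \<in> monomial_ideal V A) \<and> ?d c = (\<lambda>l. y l + var v * a l)"
      using c cyc Suc
      by (intro vec_insert_split[OF _ _ _ A] diff_map_in_vecs[OF P] homogeneous_diff_map[OF P]) auto
    then obtain y a where a: "a \<in> vecs V (rank P i')" "homogeneous_vec (shift P i') (j - 1) a"
      and y: "y \<in> vecs V (rank P i')" "\<And>l. y l \<in> monomial_ideal V A"
      and cya: "?d c = (\<lambda>l. y l + var v * a l)" by blast
    \<comment> \<open>Since the differential squares to 0 on \<open>c\<close>, \<open>var v\<close>
      times the boundary of \<open>a\<close> is minus the boundary of \<open>y\<close> and lies in
      the ideal; \<open>reg\<close> then cancels \<open>var v\<close>.\<close>
    have "diff_map P i'' a l \<in> monomial_ideal V A" if i: "i' = Suc i''" for i'' l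
    proof -
      have "diff_map P i'' (?d c) l = 0"
        using diff_map_diff_map[OF P] c(1) i Suc by simp
      hence "var v * diff_map P i'' a l = - diff_map P i'' y l"
        unfolding cya by (simp add: diff_map_add diff_map_mult eq_neg_iff_add_eq_0 add.commute)
      hence "var v * diff_map P i'' a l \<in> monomial_ideal V A"
        using ideal_uminus[OF I diff_map_in_ideal[OF P I y(2)]] by simp
      moreover have "diff_map P i'' a l \<in> polys V"
        using a(1) i by (intro vecs_polys[OF diff_map_in_vecs[OF P]]) simp
      ultimately have "diff_map P i'' a l \<in> monomial_ideal V (\<lambda>m. A (single v 1 + m))"
        by (rule var_mult_monomial_idealD)
      thus ?thesis by (simp only: reg)
    qed
    then obtain b0 where b0: "b0 \<in> vecs V (rank P i)" "\<And>l. a l - ?d b0 l \<in> monomial_ideal V A"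
      using T'[OF Suc] a Suc unfolding tor_vanishes_def by blast
    define b where "b = vhcomp (shift P i) (j - 1) b0"
    have b: "b \<in> vecs V (rank P i)" using b0(1) by (auto simp: b_def)
    have eq: "(\<lambda>l. a l - ?d b l) = vhcomp (shift P i') (j - 1) (\<lambda>l. a l - ?d b0 l)"
      unfolding b_def Suc vhcomp_diff_map[OF P] vhcomp_diff vhcomp_homogeneous[OF a(2)] ..
    have ab: "a l - ?d b l \<in> monomial_ideal V A" for l
      using hcomp_monomial_ideal[OF b0(2)[of l]] fun_cong[OF eq, of l] by (simp add: vhcomp_def)
    \<comment> \<open>The boundary of \<open>c'\<close> is \<open>y + var v * (a - ?d b)\<close>, so
      \<open>c'\<close> is a cycle modulo the smaller ideal; it differs from \<open>c\<close> by a
      multiple of \<open>var v\<close>, which vanishes modulo the larger one.\<close>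
    define c' where "c' = (\<lambda>k. c k - var v * b k)"
    have "c' \<in> vecs V (rank P i)" unfolding c'_def by (intro vec_diff c vec_mult x b)
    moreover have "homogeneous_vec (shift P i) j c'"
      unfolding homogeneous_vec_def
    proof
      fix k
      have "homogeneous (1 + (j - 1 - shift P i k)) (var v * b k)"
        by (intro homogeneous_mult homogeneous_var) (simp add: b_def vhcomp_def)
      thus "homogeneous (j - shift P i k) (c' k)"
        using c(2) unfolding c'_def homogeneous_vec_def by (intro homogeneous_diff) (auto simp: algebra_simps)
    qed
    moreover have "?d c' l \<in> monomial_ideal V A" for l
    proof -
      have "?d c' l = y l + var v * (a l - ?d b l)"
        by (simp add: c'_def diff_map_diff diff_map_mult cya algebra_simps)
      thus ?thesis using ideal_add[OF I y(2) ideal_mult[OF I x ab]] by simp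
    qed
    ultimately obtain b' where b': "b' \<in> vecs V (rank P (Suc i))"
      "\<And>l. c' l - diff_map P i b' l \<in> monomial_ideal V A"
      using T Suc unfolding tor_vanishes_def by blast
    have "c l - diff_map P i b' l \<in> monomial_ideal V ?B" for l
    proof -
      have "c l - diff_map P i b' l = (c' l - diff_map P i b' l) + var v * b l"
        by (simp add: c'_def)
      thus ?thesis using ideal_add[OF I' subsetD[OF AB b'(2)] xB[OF vecs_polys[OF b]]] by metis
    qed
    thus ?thesis using b'(1) by blast
  qed
qed

section \<open>The residue field and ideals generated by variables\<close>

definition maximal_vecs :: "'v set \<Rightarrow> (nat \<Rightarrow> ('v, 'k::field) mpoly) set" where
  "maximal_vecs V = {v \<in> vecs V 1. lookup (v 0) 0 = 0}"

text \<open>\<open>maximal_vecs V\<close> is the ideal of polynomials without constant term, seen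
  inside the free module of rank one; the quotient is the residue field, generated in degree
  0.\<close>

definition resolves_field :: "'v set \<Rightarrow> (('v, 'k::field) mpoly, 'm) free_res \<Rightarrow> bool" where
  "resolves_field V P \<longleftrightarrow> resolves V P (maximal_vecs V) \<and> rank P 0 = 1 \<and> shift P 0 = (\<lambda>_. 0)"

lemma lookup_vhcomp_0: "lookup (v k) m = 0 \<Longrightarrow> lookup (vhcomp s d v k) m = 0"
  by (simp add: vhcomp_def hcomp_def lookup_terms_with)

lemma ex_resolves_field:
  assumes "finite V"
  shows "\<exists>P :: (('v, 'k::field) mpoly, 'm) free_res. resolves_field V P"
proof -
  have "graded_submodule V 1 (\<lambda>_. 0) (maximal_vecs V :: (nat \<Rightarrow> ('v, 'k) mpoly) set)"
    unfolding graded_submodule_def submodule_of_vecs_def maximal_vecs_def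
    by (auto simp: lookup_add lookup_mult_0 lookup_vhcomp_0 simp del: One_nat_def)
  moreover have "lookup (u k) 0 = 0" if "u \<in> maximal_vecs V" for u :: "nat \<Rightarrow> ('v, 'k) mpoly" and k
    using that by (cases "k = 0") (auto simp: maximal_vecs_def vecs_def)
  ultimately show ?thesis
    unfolding resolves_field_def using ex_minimal_resolution[OF assms] by metis
qed

text \<open>The predicate selects no monomial, so the ideal is 0 and the homology is that of
  \<open>P\<close> itself: zero for \<open>i > 0\<close>, and for \<open>i = 0\<close> the residue
  field, which lives in degree 0.\<close>

lemma tor_vanishes_zero:
  assumes P: "resolves_field V (P :: (('v, 'k::field) mpoly, 'm) free_res)" and j: "j > int i"
  shows "tor_vanishes V P (monomial_ideal V (\<lambda>_. False)) i j"
  unfolding tor_vanishes_def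
proof (intro ballI impI)
  fix c assume c: "c \<in> vecs V (rank P i)" "homogeneous_vec (shift P i) j c"
    and cyc: "\<forall>i' l. i = Suc i' \<longrightarrow> diff_map P i' c l \<in> monomial_ideal V (\<lambda>_. False)"
  have P': "resolves V P (maximal_vecs V)" "rank P 0 = 1" "shift P 0 = (\<lambda>_. 0)"
    using P by (auto simp: resolves_field_def)
  have "c \<in> diff_map P i ` vecs V (rank P (Suc i))"
  proof (cases i)
    case 0
    have "homogeneous j (c 0)" using c(2) 0 P' by (simp add: homogeneous_vec_def)
    hence "0 \<notin> keys (c 0)" using j 0 unfolding homogeneous_def by force
    hence "c \<in> maximal_vecs V" using c(1) 0 P' by (simp add: maximal_vecs_def in_keys_iff)
    thus ?thesis using diff_map_0_image[OF P'(1)] 0 by simp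
  next
    case (Suc i')
    have "diff_map P i' c = (\<lambda>_. 0)"
      using cyc Suc by (auto simp: monomial_ideal_def fun_eq_iff)
    thus ?thesis using diff_map_exact[OF P'(1), of i'] c(1) Suc by blast
  qed
  thus "\<exists>b\<in>vecs V (rank P (Suc i)). \<forall>l. c l - diff_map P i b l \<in> monomial_ideal V (\<lambda>_. False)"
    by (auto simp: monomial_ideal_def)
qed

text \<open>The variables are adjoined one at a time, each being a nonzerodivisor modulo the earlier
  ones. The connecting map lowers \<open>i\<close> and \<open>j\<close> together, so the condition
  \<open>j > int i\<close> survives.\<close>

lemma tor_vanishes_variables:
  assumes P: "resolves_field V (P :: (('v, 'k::field) mpoly, 'm) free_res)"
    and Z: "finite Z" "Z \<subseteq> V" and j: "j > int i"
  shows "tor_vanishes V P (monomial_ideal V (\<lambda>m. \<exists>z\<in>Z. 0 < lookup m z)) i j"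
  using Z j
proof (induction Z arbitrary: i j rule: finite_induct)
  case empty
  thus ?case using tor_vanishes_zero[OF P] by simp
next
  case (insert v Z)
  have "tor_vanishes V P (monomial_ideal V (\<lambda>m. (\<exists>z\<in>Z. 0 < lookup m z) \<or> 0 < lookup m v)) i j"
  proof (rule tor_vanishes_insert)
    show "resolves V P (maximal_vecs V)" using P by (simp add: resolves_field_def)
    show "up_closed (\<lambda>m. \<exists>z\<in>Z. 0 < lookup m z)" by (auto simp: up_closed_def lookup_add)
    show "(\<exists>z\<in>Z. 0 < lookup (single v 1 + m) z) \<longleftrightarrow> (\<exists>z\<in>Z. 0 < lookup m z)" for m
      using insert.hyps(2) by (intro bex_cong refl) (auto simp: lookup_add lookup_single when_def)
  qed (use insert in auto)
  thus ?case by (simp add: disj_commute)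
qed


section \<open>Generators of a minimal resolution\<close>

text \<open>Dimension shifting. Let \<open>M_i\<close> be \<open>F_i\<close> modulo the image of
  \<open>F_(i+1)\<close>; the kernel of the projection from \<open>F_i\<close> to \<open>M_i\<close>
  is isomorphic to \<open>M_(i+1)\<close>. The connecting map from Tor of \<open>M_i\<close> in step
  \<open>q + 1\<close> to Tor of \<open>M_(i+1)\<close> in step \<open>q\<close> is onto: for
  \<open>q > 0\<close> because Tor of the free module \<open>F_i\<close> vanishes, for
  \<open>q = 0\<close> because the matrices of \<open>F\<close> have entries in the maximal
  ideal.\<close>

lemma tor_vanishes_syzygies:
  fixes F :: "(('v, 'k::field) mpoly, 'm) free_res" and P :: "(('v, 'k) mpoly, 'n) free_res"
  assumes P: "resolves_field V P" and F: "resolves V F N" "minimal_diffs F"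
    and T: "tor_vanishes_mod V P (rank F i) (shift F i) (diff_map F i ` vecs V (rank F (Suc i))) (Suc q) j"
  shows "tor_vanishes_mod V P (rank F (Suc i)) (shift F (Suc i))
           (diff_map F (Suc i) ` vecs V (rank F (Suc (Suc i)))) q j"
  unfolding tor_vanishes_mod_def diff_map_exact[OF F(1), symmetric]
proof (intro allI impI)
  \<comment> \<open>By exactness the submodule factored out is this kernel, so membership is tested
    by applying the differential of \<open>F\<close>.\<close>
  let ?K = "{v \<in> vecs V (rank F (Suc i)). diff_map F i v = (\<lambda>_. 0)}"
  have P': "resolves V P (maximal_vecs V)" "rank P 0 = 1" "shift P 0 = (\<lambda>_. 0)"
    using P by (auto simp: resolves_field_def)
  fix c assume c: "\<forall>k. c k \<in> vecs V (rank P q)" "\<forall>k\<ge>rank F (Suc i). c k = (\<lambda>_. 0)"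
    "\<forall>k. homogeneous_vec (shift P q) (j - shift F (Suc i) k) (c k)"
    and cyc: "\<forall>q' l. q = Suc q' \<longrightarrow> (\<lambda>k. diff_map P q' (c k) l) \<in> ?K"
  have cv: "(\<lambda>k. c k l) \<in> vecs V (rank F (Suc i))" for l
    using c(1,2) vecs_polys[of "c _" V "rank P q"] by (intro vecsI) auto
  \<comment> \<open>The image of the chain \<open>c\<close> under the differential of
    \<open>F\<close>, read as one chain of \<open>P\<close> for every basis element of
    \<open>F_i\<close>.\<close>
  define e where "e k' l = diff_map F i (\<lambda>k. c k l) k'" for k' l
  have ev: "e k' \<in> vecs V (rank P q)" for k'
  proof -
    have "e k' l \<in> polys V" for l
      unfolding e_def by (rule vecs_polys[OF diff_map_in_vecs[OF F(1) cv]])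
    moreover have "e k' l = 0" if "l \<ge> rank P q" for l
    proof -
      have "(\<lambda>k. c k l) = (\<lambda>_. 0)" using c(1) that by (auto simp: vecs_def)
      thus ?thesis by (simp add: e_def)
    qed
    ultimately show ?thesis by (simp add: vecs_def)
  qed
  have eh: "homogeneous_vec (shift P q) (j - shift F i k') (e k')" for k'
  proof -
    have "homogeneous (j - shift F i k' - shift P q l) (e k' l)" for l
    proof -
      have "homogeneous_vec (shift F (Suc i)) (j - shift P q l) (\<lambda>k. c k l)"
        using c(3) by (simp add: homogeneous_vec_def algebra_simps)
      from homogeneous_diff_map[OF F(1) this] show ?thesis
        by (simp add: homogeneous_vec_def e_def algebra_simps)
    qed
    thus ?thesis by (simp add: homogeneous_vec_def)
  qed
  \<comment> \<open>Each \<open>e k'\<close> is a boundary of \<open>P\<close>: for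
    \<open>q = 0\<close> minimality of \<open>F\<close> removes its constant term, for
    \<open>q > 0\<close> it is a cycle and \<open>P\<close> is exact.\<close>
  have eb: "e k' \<in> diff_map P q ` vecs V (rank P (Suc q))" for k'
  proof (cases q)
    case 0
    have "lookup (e k' 0) 0 = 0"
      using F(2) by (auto simp: e_def diff_map_def lookup_sum lookup_mult_0 minimal_diffs_def)
    thus ?thesis using diff_map_0_image[OF P'(1)] ev[of k'] 0 P' by (simp add: maximal_vecs_def)
  next
    case (Suc q')
    have "diff_map P q' (e k') = (\<lambda>_. 0)"
      using cyc Suc diff_map_commute[of F i P q' c _ k'] by (simp add: e_def[abs_def] fun_eq_iff)
    thus ?thesis using diff_map_exact[OF P'(1), of q'] ev[of k'] Suc by blast
  qed
  have "\<exists>b. b \<in> vecs V (rank P (Suc q)) \<and> homogeneous_vec (shift P (Suc q)) (j - shift F i k') b \<and>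
      diff_map P q b = e k' \<and> (rank F i \<le> k' \<longrightarrow> b = (\<lambda>_. 0))" for k'
  proof (cases "k' < rank F i")
    case True
    obtain b where b: "b \<in> vecs V (rank P (Suc q))" "diff_map P q b = e k'" using eb[of k'] by auto
    show ?thesis
      using True b vhcomp_diff_map[OF P'(1), of q "j - shift F i k'" b] vhcomp_homogeneous[OF eh[of k']]
      by (intro exI[of _ "vhcomp (shift P (Suc q)) (j - shift F i k') b"]) auto
  next
    case False
    hence "e k' = (\<lambda>_. 0)" by (simp add: e_def diff_map_beyond fun_eq_iff)
    thus ?thesis by (intro exI[of _ "\<lambda>_. 0"]) (auto simp: homogeneous_vec_def)
  qed
  then obtain b where b: "\<And>k'. b k' \<in> vecs V (rank P (Suc q))"
    "\<And>k'. homogeneous_vec (shift P (Suc q)) (j - shift F i k') (b k')"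
    "\<And>k'. diff_map P q (b k') = e k'" "\<And>k'. rank F i \<le> k' \<Longrightarrow> b k' = (\<lambda>_. 0)" by metis
  have "(\<lambda>k'. diff_map P q (b k') l) \<in> diff_map F i ` vecs V (rank F (Suc i))" for l
    unfolding b(3) e_def using cv[of l] by blast
  then obtain b' where b': "\<And>k. b' k \<in> vecs V (rank P (Suc (Suc q)))" "\<And>k. k \<ge> rank F i \<Longrightarrow> b' k = (\<lambda>_. 0)"
    "\<And>l. (\<lambda>k. b k l - diff_map P (Suc q) (b' k) l) \<in> diff_map F i ` vecs V (rank F (Suc i))"
    using T b unfolding tor_vanishes_mod_def by blast
  \<comment> \<open>After subtraction of the boundary of \<open>b'\<close>, the chain
    \<open>b\<close> lifts through the differential of \<open>F\<close>; the lift \<open>z\<close>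
    will bound \<open>c\<close>. Setting it to zero beyond the rank makes the transposed array a
    family of vectors for \<open>P\<close>.\<close>
  have "\<exists>z\<in>vecs V (rank F (Suc i)). (\<lambda>k. b k l - diff_map P (Suc q) (b' k) l) = diff_map F i z \<and>
      (l \<ge> rank P (Suc q) \<longrightarrow> z = (\<lambda>_. 0))" for l
  proof (cases "l \<ge> rank P (Suc q)")
    case True
    hence "(\<lambda>k. b k l - diff_map P (Suc q) (b' k) l) = (\<lambda>_. 0)"
      using b(1) by (auto simp: vecs_def diff_map_beyond)
    thus ?thesis by (intro bexI[of _ "\<lambda>_. 0"]) auto
  qed (use b'(3)[of l] in auto)
  then obtain z where z: "\<And>l. z l \<in> vecs V (rank F (Suc i))"
    "\<And>l. (\<lambda>k. b k l - diff_map P (Suc q) (b' k) l) = diff_map F i (z l)"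
    "\<And>l. l \<ge> rank P (Suc q) \<Longrightarrow> z l = (\<lambda>_. 0)" by metis
  have zv: "(\<lambda>l. z l k) \<in> vecs V (rank P (Suc q))" for k
    using z(3) vecs_polys[OF z(1)] by (intro vecsI) auto
  show "\<exists>b. (\<forall>k. b k \<in> vecs V (rank P (Suc q))) \<and> (\<forall>k\<ge>rank F (Suc i). b k = (\<lambda>_. 0)) \<and>
      (\<forall>l. (\<lambda>k. c k l - diff_map P q (b k) l) \<in> ?K)"
  proof (intro exI[of _ "\<lambda>k l. z l k"] conjI allI impI zv)
    fix k assume "k \<ge> rank F (Suc i)"
    thus "(\<lambda>l. z l k) = (\<lambda>_. 0)" using z(1) by (auto simp: vecs_def)
  next
    fix l
    have "diff_map P q (\<lambda>l. z l k) \<in> vecs V (rank P q)" for k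
      by (rule diff_map_in_vecs[OF P'(1) zv])
    moreover have "(\<lambda>l. z l k) = (\<lambda>_. 0)" if "k \<ge> rank F (Suc i)" for k
      using z(1) that by (auto simp: vecs_def)
    ultimately have "(\<lambda>k. diff_map P q (\<lambda>l. z l k) l) \<in> vecs V (rank F (Suc i))"
      using vecs_polys[of "diff_map P q _" V "rank P q"] by (intro vecsI) auto
    hence "(\<lambda>k. c k l - diff_map P q (\<lambda>l. z l k) l) \<in> vecs V (rank F (Suc i))"
      by (intro vec_diff cv)
    \<comment> \<open>Exchanging the differentials turns the image of the boundary of
      \<open>z\<close> into the boundary of \<open>b\<close>, which is \<open>e\<close>.\<close>
    moreover have "diff_map F i (\<lambda>k. c k l - diff_map P q (\<lambda>l. z l k) l) k' = 0" for k'
    proof -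
      have "diff_map F i (\<lambda>k. diff_map P q (\<lambda>l. z l k) l) k' = diff_map P q (\<lambda>l'. diff_map F i (z l') k') l"
        by (rule diff_map_commute)
      also have "\<dots> = diff_map P q (\<lambda>l'. b k' l' - diff_map P (Suc q) (b' k') l') l"
        by (simp flip: z(2))
      also have "\<dots> = e k' l"
        by (simp add: diff_map_diff diff_map_diff_map[OF P'(1) b'(1)] b(3))
      finally show ?thesis by (simp add: diff_map_diff e_def)
    qed
    ultimately show "(\<lambda>k. c k l - diff_map P q (\<lambda>l. z l k) l) \<in> ?K" by auto
  qed
qed

text \<open>Sending \<open>v\<close> to the sum of the \<open>v k * p k\<close> induces an
  isomorphism from the free module modulo the displayed submodule onto S/I, with inverse sending 1
  to the class of \<open>w\<close>. This carries the vanishing over to a resolution whose first free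
  module has any rank and basis.\<close>

lemma tor_vanishes_presentation:
  fixes P :: "(('v, 'k::field) mpoly, 'm) free_res"
  assumes P: "resolves V P M" and I: "poly_ideal V I"
    and p: "\<And>k. k < n \<Longrightarrow> p k \<in> polys V" "\<And>k. k < n \<Longrightarrow> homogeneous (s k) (p k)"
    and w: "w \<in> vecs V n" "1 - (\<Sum>k<n. w k * p k) \<in> I"
    and T: "tor_vanishes V P I i j"
  shows "tor_vanishes_mod V P n s {v \<in> vecs V n. (\<Sum>k<n. v k * p k) \<in> I} i j"
  unfolding tor_vanishes_mod_def
proof (intro allI impI)
  let ?K = "{v \<in> vecs V n. (\<Sum>k<n. v k * p k) \<in> I}"
  fix c assume c: "\<forall>k. c k \<in> vecs V (rank P i)" "\<forall>k\<ge>n. c k = (\<lambda>_. 0)"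
    "\<forall>k. homogeneous_vec (shift P i) (j - s k) (c k)"
    and cyc: "\<forall>i' l. i = Suc i' \<longrightarrow> (\<lambda>k. diff_map P i' (c k) l) \<in> ?K"
  define c' where "c' = (\<lambda>l. \<Sum>k<n. p k * c k l)"
  have dc': "diff_map P i' c' l = (\<Sum>k<n. p k * diff_map P i' (c k) l)" for i' l
    by (simp add: c'_def diff_map_sum diff_map_mult)
  have "c' \<in> vecs V (rank P i)"
    using c(1) p(1) vecs_polys[of "c _" V "rank P i"]
    by (auto simp: c'_def vecs_def[of _ "rank P i"] intro!: vecsI polys_sum polys_mult)
  moreover have "homogeneous_vec (shift P i) j c'"
    unfolding homogeneous_vec_def c'_def
  proof (intro allI homogeneous_sum)
    fix l k assume "k \<in> {..<n}"
    hence "homogeneous (s k + (j - s k - shift P i l)) (p k * c k l)"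
      using c(3) p(2) by (intro homogeneous_mult) (auto simp: homogeneous_vec_def)
    thus "homogeneous (j - shift P i l) (p k * c k l)" by (simp add: algebra_simps)
  qed
  moreover have "diff_map P i' c' l \<in> I" if "i = Suc i'" for i' l
    using cyc that by (simp add: dc' mult.commute)
  ultimately obtain b where b: "b \<in> vecs V (rank P (Suc i))" "\<And>l. c' l - diff_map P i b l \<in> I"
    using T unfolding tor_vanishes_def by blast
  have db: "diff_map P i b l \<in> polys V" for l
    by (rule vecs_polys[OF diff_map_in_vecs[OF P b(1)]])
  show "\<exists>b. (\<forall>k. b k \<in> vecs V (rank P (Suc i))) \<and> (\<forall>k\<ge>n. b k = (\<lambda>_. 0)) \<and>
      (\<forall>l. (\<lambda>k. c k l - diff_map P i (b k) l) \<in> ?K)"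
  proof (intro exI[of _ "\<lambda>k l. w k * b l"] conjI allI impI)
    show "(\<lambda>l. w k * b l) \<in> vecs V (rank P (Suc i))" for k
      by (intro vec_mult b vecs_polys[OF w(1)])
    show "(\<lambda>l. w k * b l) = (\<lambda>_. 0)" if "k \<ge> n" for k
      using w(1) that by (simp add: vecs_def)
    fix l
    have "(\<lambda>k. c k l - w k * diff_map P i b l) \<in> vecs V n"
      using c(1,2) w(1) db[of l] vecs_polys[of "c _" V "rank P i"] vecs_polys[OF w(1)]
      by (intro vecsI polys_diff polys_mult) (auto simp: vecs_def[of _ n])
    moreover have "(\<Sum>k<n. (c k l - w k * diff_map P i b l) * p k) =
        (c' l - diff_map P i b l) + diff_map P i b l * (1 - (\<Sum>k<n. w k * p k))"
      by (simp add: c'_def algebra_simps sum_subtractf sum_distrib_left)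
    ultimately show "(\<lambda>k. c k l - diff_map P i (\<lambda>l. w k * b l) l) \<in> ?K"
      using ideal_add[OF I b(2) ideal_mult[OF I db w(2)]] by (simp add: diff_map_mult)
  qed
qed

text \<open>Descending along the syzygies, the hypothesis becomes the vanishing in degree
  \<open>j\<close> of the residue field tensored with \<open>F_i\<close> modulo the image of
  \<open>F_(i+1)\<close>. That image has no constant terms, so a basis element of degree
  \<open>j\<close> would survive there.\<close>

theorem minimal_resolution_shift:
  fixes F :: "(('v, 'k::field) mpoly, 'm) free_res" and P :: "(('v, 'k) mpoly, 'n) free_res"
  assumes P: "resolves_field V P" and F: "resolves V F N" "minimal_diffs F"
    and T: "tor_vanishes_mod V P (rank F 0) (shift F 0) N i j" and k: "k < rank F i"
  shows "shift F i k \<noteq> j"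
proof
  assume j: "shift F i k = j"
  have P': "resolves V P (maximal_vecs V)" "rank P 0 = 1" "shift P 0 = (\<lambda>_. 0)"
    using P by (auto simp: resolves_field_def)
  let ?N = "\<lambda>t. diff_map F t ` vecs V (rank F (Suc t))"
  have "tor_vanishes_mod V P (rank F t) (shift F t) (?N t) (i - t) j" if "t \<le> i" for t
    using that
  proof (induction t)
    case 0
    show ?case using T diff_map_0_image[OF F(1)] by simp
  next
    case (Suc t)
    hence "i - t = Suc (i - Suc t)" by simp
    thus ?case using Suc tor_vanishes_syzygies[OF P F, of t "i - Suc t" j] by simp
  qed
  hence T': "tor_vanishes_mod V P (rank F i) (shift F i) (?N i) 0 j" by fastforce
  define c where "c k' l = (if k' = k \<and> l = 0 then 1 else 0 :: ('v, 'k) mpoly)" for k' l :: nat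
  have "\<forall>k. c k \<in> vecs V (rank P 0)" "\<forall>k\<ge>rank F i. c k = (\<lambda>_. 0)"
    "\<forall>k. homogeneous_vec (shift P 0) (j - shift F i k) (c k)"
    using k by (auto simp: c_def vecs_def homogeneous_vec_def P' j)
  then obtain b where b: "\<And>k. b k \<in> vecs V (rank P (Suc 0))"
    "\<And>l. (\<lambda>k. c k l - diff_map P 0 (b k) l) \<in> ?N i"
    using T' unfolding tor_vanishes_mod_def by blast
  obtain z where z: "(\<lambda>k. c k 0 - diff_map P 0 (b k) 0) = diff_map F i z" using b(2)[of 0] by blast
  have "diff_map P 0 (b k) \<in> maximal_vecs V" using diff_map_0_image[OF P'(1)] b(1) by blast
  hence "lookup (c k 0 - diff_map P 0 (b k) 0) 0 = 1"
    by (simp add: maximal_vecs_def lookup_minus c_def)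
  moreover have "lookup (diff_map F i z k) 0 = 0"
    using F(2) by (simp add: diff_map_def lookup_sum lookup_mult_0 minimal_diffs_def)
  ultimately show False using fun_cong[OF z, of k] by simp
qed


section \<open>Edge ideals of graphs\<close>

text \<open>The monomials in the ideal generated by the edges inside \<open>U\<close> and the variables in \<open>Z\<close>.\<close>
definition graph_monom :: "'v set set \<Rightarrow> 'v set \<Rightarrow> 'v set \<Rightarrow> ('v \<Rightarrow>\<^sub>0 nat) \<Rightarrow> bool" where
  "graph_monom E U Z m \<longleftrightarrow> (\<exists>z\<in>Z. 0 < lookup m z) \<or>
     (\<exists>a b. {a, b} \<in> E \<and> a \<in> U \<and> b \<in> U \<and> 0 < lookup m a \<and> 0 < lookup m b)"

lemma up_closed_graph_monom: "up_closed (graph_monom E U Z)"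
  unfolding up_closed_def graph_monom_def by (fastforce simp: lookup_add)

text \<open>Once the variable \<open>v\<close> is a generator, all edges at \<open>v\<close> are
  redundant.\<close>

lemma graph_monom_insert:
  "graph_monom E U Z m \<or> 0 < lookup m v \<longleftrightarrow> graph_monom E (U - {v}) (insert v Z) m"
proof (cases "0 < lookup m v")
  case False
  hence "(\<exists>a b. {a, b} \<in> E \<and> a \<in> U \<and> b \<in> U \<and> 0 < lookup m a \<and> 0 < lookup m b) \<longleftrightarrow>
      (\<exists>a b. {a, b} \<in> E \<and> a \<in> U - {v} \<and> b \<in> U - {v} \<and> 0 < lookup m a \<and> 0 < lookup m b)"
    by (intro ex_cong1) auto
  thus ?thesis using False unfolding graph_monom_def by blast
qed (simp add: graph_monom_def)

text \<open>In the colon ideal every edge at \<open>v\<close> is replaced by its other end, a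
  variable; the remaining edges at the neighbours become redundant, and no generator involves
  \<open>v\<close> any more. The condition on \<open>card\<close> excludes loops, for which
  \<open>{a, b}\<close> would be a singleton.\<close>

lemma graph_monom_colon:
  assumes "v \<in> U" "v \<notin> Z" "\<And>e. e \<in> E \<Longrightarrow> card e = 2"
  shows "graph_monom E U Z (single v 1 + m) \<longleftrightarrow>
    graph_monom E (U - insert v {u. {u, v} \<in> E}) (Z \<union> ({u. {u, v} \<in> E} \<inter> U)) m"
    (is "?L \<longleftrightarrow> ?R")
proof
  have ne: "a \<noteq> b" if "{a, b} \<in> E" for a b using assms(3)[OF that] by auto
  have l: "0 < lookup (single v 1 + m) u \<longleftrightarrow> u = v \<or> 0 < lookup m u" for u
    by (auto simp: lookup_add lookup_single when_def)
  show ?R if ?L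
  proof -
    consider z where "z \<in> Z" "0 < lookup m z"
      | a b where "{a, b} \<in> E" "a \<in> U" "b \<in> U" "a = v \<or> 0 < lookup m a" "b = v \<or> 0 < lookup m b"
      using \<open>?L\<close> assms(2) unfolding graph_monom_def l by blast
    thus ?R
    proof cases
      case 2
      show ?R
      proof (cases "a = v \<or> b = v \<or> {a, v} \<in> E \<or> {b, v} \<in> E")
        case True
        have "\<exists>z\<in>{u. {u, v} \<in> E} \<inter> U. 0 < lookup m z"
          using True 2 ne[OF 2(1)] by (auto simp: insert_commute)
        thus ?R unfolding graph_monom_def by blast
      next
        case False
        thus ?R using 2 unfolding graph_monom_def by blast
      qed
    qed (auto simp: graph_monom_def)
  qed
  show ?L if ?R
    using \<open>?R\<close> assms(1) unfolding graph_monom_def l by blast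
qed

lemma graph_monom_independent:
  assumes "\<forall>e\<in>E. \<not> e \<subseteq> U"
  shows "graph_monom E U Z m \<longleftrightarrow> (\<exists>z\<in>Z. 0 < lookup m z)"
proof -
  have "\<not> (a \<in> U \<and> b \<in> U)" if "{a, b} \<in> E" for a b
    using bspec[OF assms that] by simp
  thus ?thesis unfolding graph_monom_def by metis
qed

text \<open>\<open>reg S/I \<le> r\<close> for every ideal \<open>I\<close> generated by the edges of an induced subgraph on
  a subset of \<open>W\<close> and by further variables.\<close>
definition reg_le ::
  "'v set \<Rightarrow> (('v, 'k::field) mpoly, 'm) free_res \<Rightarrow> 'v set set \<Rightarrow> 'v set \<Rightarrow> nat \<Rightarrow> bool" where
  "reg_le V P E W r \<longleftrightarrow> (\<forall>U Z i j. U \<subseteq> W \<longrightarrow> Z \<subseteq> V \<longrightarrow> Z \<inter> U = {} \<longrightarrow> int i + int r < j \<longrightarrow>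
     tor_vanishes V P (monomial_ideal V (graph_monom E U Z)) i j)"

lemma reg_le_mono: "reg_le V P E W r \<Longrightarrow> W' \<subseteq> W \<Longrightarrow> r \<le> r' \<Longrightarrow> reg_le V P E W' r'"
  unfolding reg_le_def by (meson add_left_mono of_nat_mono order.strict_trans1 order_trans)

section \<open>Removing vertices, edges and cycles\<close>

context
  fixes V and P :: "(('v, 'k::field) mpoly, 'm) free_res" and E :: "'v set set"
  assumes V: "finite V" and P: "resolves_field V P"
    and E: "\<And>e. e \<in> E \<Longrightarrow> e \<subseteq> V \<and> card e = 2"
begin

lemma reg_le_independent:
  assumes "\<forall>e\<in>E. \<not> e \<subseteq> W"
  shows "reg_le V P E W 0"
  unfolding reg_le_def
proof (intro allI impI)
  fix U Z i j assume *: "U \<subseteq> W" "Z \<subseteq> V" "int i + int 0 < j"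
  have "\<forall>e\<in>E. \<not> e \<subseteq> U" using assms *(1) by blast
  hence "graph_monom E U Z = (\<lambda>m. \<exists>z\<in>Z. 0 < lookup m z)"
    by (intro ext graph_monom_independent)
  thus "tor_vanishes V P (monomial_ideal V (graph_monom E U Z)) i j"
    using tor_vanishes_variables[OF P finite_subset[OF *(2) V] *(2), of i j] *(3) by simp
qed

text \<open>The colon term of the exact sequence is twisted by one, so the bound \<open>r\<close>
  for it counts as \<open>Suc r\<close>. There the neighbours of \<open>v\<close> in
  \<open>U\<close> move into \<open>Z\<close>. If \<open>v\<close> is not in \<open>U\<close>, the
  bound for \<open>W - {v}\<close> applies directly.\<close>

lemma reg_le_vertex:
  assumes v: "v \<in> V" and del: "reg_le V P E (W - {v}) (Suc r)"
    and link: "reg_le V P E (W - insert v {u. {u, v} \<in> E}) r"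
  shows "reg_le V P E W (Suc r)"
  unfolding reg_le_def
proof (intro allI impI)
  fix U Z i j assume *: "U \<subseteq> W" "Z \<subseteq> V" "Z \<inter> U = {}" "int i + int (Suc r) < j"
  show "tor_vanishes V P (monomial_ideal V (graph_monom E U Z)) i j"
  proof (cases "v \<in> U")
    case False
    thus ?thesis using del * unfolding reg_le_def by blast
  next
    case True
    let ?N = "{u. {u, v} \<in> E}"
    have NV: "?N \<subseteq> V" using E by blast
    have vZ: "v \<notin> Z" using True *(3) by blast
    show ?thesis
    proof (rule tor_vanishes_colon[OF _ up_closed_graph_monom v])
      show "resolves V P (maximal_vecs V)" using P by (simp add: resolves_field_def)
      have "tor_vanishes V P (monomial_ideal V (graph_monom E (U - insert v ?N) (Z \<union> (?N \<inter> U)))) i (j - 1)"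
        using link[unfolded reg_le_def, rule_format, of "U - insert v ?N" "Z \<union> (?N \<inter> U)" i "j - 1"]
          * NV by auto
      thus "tor_vanishes V P (monomial_ideal V (\<lambda>m. graph_monom E U Z (single v 1 + m))) i (j - 1)"
        using graph_monom_colon[OF True vZ, of E] E by presburger
      have "tor_vanishes V P (monomial_ideal V (graph_monom E (U - {v}) (insert v Z))) i j"
        using del[unfolded reg_le_def, rule_format, of "U - {v}" "insert v Z" i j] * v by auto
      thus "tor_vanishes V P (monomial_ideal V (\<lambda>m. graph_monom E U Z m \<or> 0 < lookup m v)) i j"
        using graph_monom_insert[of E U Z _ v] by presburger
    qed
  qed
qed

text \<open>\<open>reg_le_vertex\<close> is applied to \<open>a\<close> and then to
  \<open>b\<close>; in every case covered by the smaller bound both ends are gone. Endpoints may lie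
  outside \<open>W\<close>, which happens when the neighbourhood of a cycle vertex swallows further
  cycle vertices through chords.\<close>

lemma reg_le_edge:
  assumes ab: "{a, b} \<in> E" and r: "reg_le V P E (W - {a, b}) r"
  shows "reg_le V P E W (Suc r)"
proof (rule reg_le_vertex)
  show "a \<in> V" using E[OF ab] by blast
  show "reg_le V P E (W - insert a {u. {u, a} \<in> E}) r"
    using ab by (intro reg_le_mono[OF r]) (auto simp: insert_commute)
  show "reg_le V P E (W - {a}) (Suc r)"
  proof (rule reg_le_vertex)
    show "b \<in> V" using E[OF ab] by blast
    show "reg_le V P E (W - {a} - insert b {u. {u, b} \<in> E}) r"
      by (intro reg_le_mono[OF r]) auto
    show "reg_le V P E (W - {a} - {b}) (Suc r)"
      by (intro reg_le_mono[OF r]) auto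
  qed
qed

lemma reg_le_edges:
  assumes "\<And>i. i < m \<Longrightarrow> {a i, b i} \<in> E" "reg_le V P E (W - (\<Union>i<m. {a i, b i})) r"
  shows "reg_le V P E W (r + m)"
  using assms
proof (induction m arbitrary: W)
  case (Suc m)
  have "reg_le V P E (W - {a m, b m}) (r + m)"
    using Suc.prems by (intro Suc.IH reg_le_mono[OF Suc.prems(2)]) (auto simp: lessThan_Suc)
  thus ?case using reg_le_edge[OF Suc.prems(1)[of m]] by simp
qed simp

text \<open>An odd cycle \<open>g 0, \<dots>, g (2m)\<close>: both deleting \<open>g 0\<close> and deleting its closed neighbourhood
  leave paths with a perfect matching.\<close>
lemma reg_le_odd_cycle:
  assumes path: "\<And>i. Suc i < 2 * m + 1 \<Longrightarrow> {g i, g (Suc i)} \<in> E" and cyc: "{g 0, g (2 * m)} \<in> E"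
    and m: "m \<ge> 1" and r: "reg_le V P E (W - g ` {..<2 * m + 1}) r"
  shows "reg_le V P E W (r + m)"
proof -
  obtain m' where m': "m = Suc m'" using m by (cases m) auto
  have "reg_le V P E W (Suc (r + m'))"
  proof (rule reg_le_vertex)
    show "g 0 \<in> V" using E[OF cyc] by blast
    have "reg_le V P E (W - {g 0} - (\<Union>i<m. {g (2 * i + 1), g (2 * i + 2)})) r"
    proof (rule reg_le_mono[OF r])
      have "g n \<in> {g 0} \<union> (\<Union>i<m. {g (2 * i + 1), g (2 * i + 2)})" if "n < 2 * m + 1" for n
      proof -
        consider "n = 0" | i where "n = 2 * i + 1" | i where "n = 2 * i + 2"
        proof -
          have "n = 0 \<or> (\<exists>i. n = 2 * i + 1) \<or> (\<exists>i. n = 2 * i + 2)" by presburger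
          thus thesis using that by blast
        qed
        thus ?thesis using that by cases auto
      qed
      thus "W - {g 0} - (\<Union>i<m. {g (2 * i + 1), g (2 * i + 2)}) \<subseteq> W - g ` {..<2 * m + 1}" by blast
    qed simp
    hence "reg_le V P E (W - {g 0}) (r + m)"
      using path[of "2 * _ + 1"] by (intro reg_le_edges) auto
    thus "reg_le V P E (W - {g 0}) (Suc (r + m'))" by (simp add: m')
    \<comment> \<open>Chords may enlarge \<open>?N\<close>, but it contains \<open>g 1\<close> and
      \<open>g (2 * m)\<close>; the vertices from \<open>g 2\<close> to \<open>g (2 * m - 1)\<close>
      are paired by \<open>m'\<close> edges, one fewer than \<open>m\<close>, as the colon term
      demands.\<close>
    let ?N = "{u. {u, g 0} \<in> E}"
    have "reg_le V P E (W - insert (g 0) ?N - (\<Union>i<m'. {g (2 * i + 2), g (2 * i + 3)})) r"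
    proof (rule reg_le_mono[OF r])
      have N: "g (Suc 0) \<in> ?N" "g (2 * m) \<in> ?N"
        using path[of 0] cyc m by (auto simp: insert_commute)
      have "g n \<in> insert (g 0) ?N \<union> (\<Union>i<m'. {g (2 * i + 2), g (2 * i + 3)})" if "n < 2 * m + 1" for n
      proof -
        consider "n = 0" | "n = 1" | "n = 2 * m" | i where "n = 2 * i + 2" "n < 2 * m" | i where "n = 2 * i + 3"
        proof -
          have "n = 0 \<or> n = 1 \<or> n = 2 * m \<or> (\<exists>i. n = 2 * i + 2 \<and> n < 2 * m) \<or> (\<exists>i. n = 2 * i + 3)"
            using \<open>n < 2 * m + 1\<close> by presburger
          thus thesis using that by blast
        qed
        thus ?thesis
        proof cases
          case (4 i) thus ?thesis by (auto simp: m')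
        next
          case (5 i) thus ?thesis using that by (auto simp: m')
        qed (use N in auto)
      qed
      thus "W - insert (g 0) ?N - (\<Union>i<m'. {g (2 * i + 2), g (2 * i + 3)}) \<subseteq> W - g ` {..<2 * m + 1}"
        by blast
    qed simp
    moreover have "{g (2 * i + 2), g (2 * i + 3)} \<in> E" if "i < m'" for i
      using path[of "2 * i + 2"] that by (simp add: m' numeral_3_eq_3)
    ultimately show "reg_le V P E (W - insert (g 0) ?N) (r + m')"
      by (intro reg_le_edges)
  qed
  thus ?thesis by (simp add: m')
qed

lemma reg_le_even_path:
  assumes "\<And>i. Suc i < 2 * m \<Longrightarrow> {g i, g (Suc i)} \<in> E" "reg_le V P E (W - g ` {..<2 * m}) r"
  shows "reg_le V P E W (r + m)"
proof (rule reg_le_edges)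
  show "{g (2 * i), g (2 * i + 1)} \<in> E" if "i < m" for i using assms(1)[of "2 * i"] that by simp
  show "reg_le V P E (W - (\<Union>i<m. {g (2 * i), g (2 * i + 1)})) r"
  proof (rule reg_le_mono[OF assms(2)])
    have "g n \<in> (\<Union>i<m. {g (2 * i), g (2 * i + 1)})" if "n < 2 * m" for n
    proof -
      have "\<exists>i. n = 2 * i \<or> n = 2 * i + 1" by presburger
      then obtain i where "n = 2 * i \<or> n = 2 * i + 1" ..
      thus ?thesis using that by auto
    qed
    thus "W - (\<Union>i<m. {g (2 * i), g (2 * i + 1)}) \<subseteq> W - g ` {..<2 * m}" by blast
  qed simp
qed

text \<open>The matching itself is returned, not only its size, because the matchings of different
  components have to be united into one matching of the whole subgraph.\<close>

lemma reg_le_component: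
  fixes C :: "'v graph"
  assumes iso: "graph_iso C D" and D: "D = complete_graph 2 \<or> (\<exists>k\<ge>3. D = cycle_graph k)"
    and C: "\<And>e. e \<in> edges C \<Longrightarrow> e \<subseteq> verts C \<and> e \<in> E"
  shows "\<exists>M. M \<subseteq> edges C \<and> finite M \<and> pairwise disjnt M \<and>
           (\<forall>W r. reg_le V P E (W - verts C) r \<longrightarrow> reg_le V P E W (r + card M))"
proof -
  obtain f where f: "bij_betw f (verts C) (verts D)" "(\<lambda>e. f ` e) ` edges C = edges D"
    using iso by (auto simp: graph_iso_def)
  define g where "g = inv_into (verts C) f"
  \<comment> \<open>Both kinds of graph are treated as paths on \<open>{..<k}\<close>, with
    \<open>k = 2\<close> for the complete graph; for odd \<open>k\<close> the closing edge of the
    cycle is recorded as well.\<close>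
  obtain k where k: "k \<ge> 2" "verts D = {..<k}" "\<And>i. Suc i < k \<Longrightarrow> {i, Suc i} \<in> edges D"
    "odd k \<Longrightarrow> {0, k - 1} \<in> edges D"
  proof -
    show thesis if "\<And>k. k \<ge> 2 \<Longrightarrow> verts D = {..<k} \<Longrightarrow> (\<And>i. Suc i < k \<Longrightarrow> {i, Suc i} \<in> edges D) \<Longrightarrow>
        (odd k \<Longrightarrow> {0, k - 1} \<in> edges D) \<Longrightarrow> thesis"
      using D
    proof
      assume "D = complete_graph 2"
      thus thesis by (intro that[of 2]) (auto simp: complete_graph_def)
    next
      assume "\<exists>k\<ge>3. D = cycle_graph k"
      then obtain k where k: "k \<ge> 3" "D = cycle_graph k" by blast
      show thesis
      proof (rule that[of k])
        show "{i, Suc i} \<in> edges D" if "Suc i < k" for i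
          using that k unfolding cycle_graph_def by (auto intro!: exI[of _ i])
        show "{0, k - 1} \<in> edges D"
          using k unfolding cycle_graph_def by (auto intro!: exI[of _ "k - 1"])
      qed (use k in \<open>auto simp: cycle_graph_def\<close>)
    qed
  qed
  have g: "inj_on g {..<k}" "g ` {..<k} = verts C"
    using bij_betw_inv_into[OF f(1)] by (auto simp: g_def k(2) bij_betw_def)
  have gE: "{g i, g j} \<in> edges C" if ij: "{i, j} \<in> edges D" for i j
  proof -
    have "{i, j} \<in> (\<lambda>e. f ` e) ` edges C" using ij f(2) by simp
    then obtain e where e: "e \<in> edges C" "f ` e = {i, j}" by auto
    have "g ` f ` e = e"
      using C[OF e(1)] f(1) unfolding g_def by (intro inv_into_image_cancel) (auto simp: bij_betw_def)
    thus ?thesis using e by simp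
  qed
  have path: "{g i, g (Suc i)} \<in> edges C" if "Suc i < k" for i using gE k(3) that by blast
  define m where "m = k div 2"
  define M where "M = (\<lambda>i. {g (2 * i), g (2 * i + 1)}) ` {..<m}"
  have disj: "disjnt {g (2 * i), g (2 * i + 1)} {g (2 * j), g (2 * j + 1)}" if "i < m" "j < m" "i \<noteq> j" for i j
  proof -
    have "g a \<noteq> g b" if "a < k" "b < k" "a \<noteq> b" for a b using g(1) that by (auto simp: inj_on_def)
    moreover have "2 * i + 1 < k" "2 * j + 1 < k" using that unfolding m_def by auto
    moreover have "2 * i \<noteq> 2 * j" "2 * i \<noteq> 2 * j + 1" "2 * i + 1 \<noteq> 2 * j" "2 * i + 1 \<noteq> 2 * j + 1"
      using that by presburger+
    ultimately show ?thesis by (auto simp: disjnt_def)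
  qed
  have "inj_on (\<lambda>i. {g (2 * i), g (2 * i + 1)}) {..<m}"
    using disj by (intro inj_onI) (metis disjnt_insert1 insertI1 lessThan_iff)
  hence card: "card M = m" by (simp add: M_def card_image)
  have "M \<subseteq> edges C" using path unfolding M_def m_def by auto
  moreover have "pairwise disjnt M"
  proof (rule pairwiseI)
    fix x y assume "x \<in> M" "y \<in> M" "x \<noteq> y"
    then obtain i j where "i < m" "j < m" "i \<noteq> j"
      and xy: "x = {g (2 * i), g (2 * i + 1)}" "y = {g (2 * j), g (2 * j + 1)}" unfolding M_def by blast
    thus "disjnt x y" unfolding xy by (intro disj)
  qed
  moreover have "reg_le V P E W (r + m)" if r: "reg_le V P E (W - verts C) r" for W r
  proof (cases "even k")
    case True
    hence "k = 2 * m" by (simp add: m_def)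
    thus ?thesis using path C r g(2) by (intro reg_le_even_path[of m g]) auto
  next
    case False
    hence km: "k = 2 * m + 1" by (simp add: m_def)
    show ?thesis
    proof (rule reg_le_odd_cycle[of m g])
      show "m \<ge> 1" using k(1) km by simp
      show "{g 0, g (2 * m)} \<in> E" using C gE k(4) False km by fastforce
      show "reg_le V P E (W - g ` {..<2 * m + 1}) r" using r g(2) km by simp
      show "{g i, g (Suc i)} \<in> E" if "Suc i < 2 * m + 1" for i using C path km that by blast
    qed
  qed
  moreover have "finite M" by (simp add: M_def)
  ultimately show ?thesis using card by (intro exI[of _ M]) auto
qed

end

section \<open>Connected components and their matchings\<close>

lemma simple_graph_finite_edges:
  assumes "simple_graph G"
  shows "finite (edges G)"
proof (rule finite_subset)
  show "edges G \<subseteq> Pow (verts G)" "finite (Pow (verts G))"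
    using assms unfolding simple_graph_def by blast+
qed

lemma reachable_sym: "reachable G u v \<Longrightarrow> reachable G v u"
  unfolding reachable_def
  by (rule sympD[OF symp_rtranclp]) (auto simp: symp_def insert_commute)

lemma reachable_trans: "reachable G u v \<Longrightarrow> reachable G v w \<Longrightarrow> reachable G u w"
  unfolding reachable_def by (rule rtranclp_trans)

lemma component_disjoint:
  assumes "C \<in> connected_components H" "C' \<in> connected_components H" "C \<noteq> C'"
  shows "verts C \<inter> verts C' = {}"
proof (rule ccontr)
  obtain v v' where C: "C = induced_subgraph H {w \<in> verts H. reachable H v w}"
    "C' = induced_subgraph H {w \<in> verts H. reachable H v' w}"
    using assms by (auto simp: connected_components_def)
  assume "verts C \<inter> verts C' \<noteq> {}"
  then obtain w where "reachable H v w" "reachable H v' w" by (auto simp: C induced_subgraph_def)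
  hence "reachable H v v'" "reachable H v' v"
    by (blast intro: reachable_sym reachable_trans)+
  hence "reachable H v w \<longleftrightarrow> reachable H v' w" for w
    by (blast intro: reachable_trans)
  thus False using assms(3) by (simp add: C)
qed

lemma component_edges:
  "C \<in> connected_components H \<Longrightarrow> e \<in> edges C \<Longrightarrow> e \<in> edges H \<and> e \<subseteq> verts C"
  by (auto simp: connected_components_def induced_subgraph_def)

lemma verts_components: "(\<Union>C\<in>connected_components H. verts C) = verts H"
  by (auto simp: connected_components_def induced_subgraph_def reachable_def)

lemma finite_components: "finite (verts H) \<Longrightarrow> finite (connected_components H)"
  by (simp add: connected_components_def)

text \<open>The components are peeled off one by one, and a matching of each is collected. Their
  union is a matching of \<open>H\<close>, so its size is at most
  \<open>matching_number H\<close>.\<close>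

lemma reg_le_family_subgraph:
  fixes P :: "(('v, 'k::field) mpoly, 'm) free_res"
  assumes V: "finite V" and P: "resolves_field V P" and E: "\<And>e. e \<in> E \<Longrightarrow> e \<subseteq> V \<and> card e = 2"
    and H: "simple_graph H" "edges H \<subseteq> E"
    and D: "\<forall>C\<in>connected_components H. \<exists>D. (D = complete_graph 2 \<or> (\<exists>k\<ge>3. D = cycle_graph k)) \<and> graph_iso C D"
    and r: "reg_le V P E (W - verts H) r"
  shows "reg_le V P E W (r + matching_number H)"
proof -
  have "\<exists>M\<subseteq>edges H. finite M \<and> pairwise disjnt M \<and> \<Union>M \<subseteq> (\<Union>C\<in>S. verts C) \<and>
      (\<forall>W r. reg_le V P E (W - (\<Union>C\<in>S. verts C)) r \<longrightarrow> reg_le V P E W (r + card M))"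
    if "finite S" "S \<subseteq> connected_components H" for S
    using that
  proof (induction S rule: finite_induct)
    case empty
    show ?case by (intro exI[of _ "{}"]) simp
  next
    case (insert C S)
    have "S \<subseteq> connected_components H" and C: "C \<in> connected_components H" using insert.prems by auto
    then obtain M where M: "M \<subseteq> edges H" "finite M" "pairwise disjnt M" "\<Union>M \<subseteq> (\<Union>C\<in>S. verts C)"
      "\<And>W r. reg_le V P E (W - (\<Union>C\<in>S. verts C)) r \<Longrightarrow> reg_le V P E W (r + card M)"
      using insert.IH by auto
    obtain D where D': "D = complete_graph 2 \<or> (\<exists>k\<ge>3. D = cycle_graph k)" "graph_iso C D"
      using D C by blast
    have CE: "e \<subseteq> verts C \<and> e \<in> E" if "e \<in> edges C" for e
      using component_edges[OF C that] H(2) by blast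
    obtain N where N: "N \<subseteq> edges C" "finite N" "pairwise disjnt N"
      "\<And>W r. reg_le V P E (W - verts C) r \<Longrightarrow> reg_le V P E W (r + card N)"
      using reg_le_component[OF V P E D'(2,1) CE] by blast
    have vdisj: "verts C \<inter> (\<Union>C\<in>S. verts C) = {}"
      using component_disjoint[OF C] insert.hyps(2) insert.prems by blast
    have NC: "\<Union>N \<subseteq> verts C" using N(1) CE by blast
    have ND: "disjnt e e'" if "e \<in> M" "e' \<in> N" for e e'
      using that M(4) NC vdisj unfolding disjnt_def by blast
    \<comment> \<open>An edge common to both matchings would be disjoint from itself, hence
      empty.\<close>
    have "M \<inter> N = {}"
    proof (rule ccontr)
      assume "M \<inter> N \<noteq> {}"
      then obtain e where e: "e \<in> M" "e \<in> N" by blast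
      hence "e = {}" using ND[OF e] by (simp add: disjnt_def)
      thus False using E[of e] e M(1) H(2) by auto
    qed
    hence card: "card (M \<union> N) = card M + card N" using M(2) N(2) by (intro card_Un_disjoint)
    show ?case
    proof (intro exI[of _ "M \<union> N"] conjI allI impI)
      show "M \<union> N \<subseteq> edges H" using M(1) N(1) component_edges[OF C] by blast
      show "finite (M \<union> N)" using M(2) N(2) by simp
      show "pairwise disjnt (M \<union> N)"
        using M(3) N(3) ND by (auto simp: pairwise_def disjnt_sym)
      show "\<Union>(M \<union> N) \<subseteq> (\<Union>C\<in>insert C S. verts C)" using M(4) NC by auto
      fix W r assume "reg_le V P E (W - (\<Union>C\<in>insert C S. verts C)) r"
      moreover have "W - (\<Union>C\<in>insert C S. verts C) = W - (\<Union>C\<in>S. verts C) - verts C" by auto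
      ultimately have "reg_le V P E (W - (\<Union>C\<in>S. verts C)) (r + card N)" using N(4) by simp
      from M(5)[OF this] show "reg_le V P E W (r + card (M \<union> N))"
        by (simp add: card add.assoc add.commute add.left_commute)
    qed
  qed
  from this[OF finite_components order_refl] obtain M where M: "M \<subseteq> edges H" "pairwise disjnt M"
    "\<And>W r. reg_le V P E (W - verts H) r \<Longrightarrow> reg_le V P E W (r + card M)"
    using H(1) unfolding verts_components simple_graph_def by blast
  have "finite (edges H)" by (rule simple_graph_finite_edges[OF H(1)])
  hence "finite {M. M \<subseteq> edges H}" by simp
  hence "finite {M. matching H M}"
    by (rule rev_finite_subset) (auto simp: matching_def)
  hence "finite {card M |M. matching H M}" by simp
  hence "card M \<le> matching_number H"
    unfolding matching_number_def using M(1,2) by (intro Max_ge) (auto simp: matching_def)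
  thus ?thesis using reg_le_mono[OF M(3)[OF r] order_refl] by simp
qed


section \<open>Maximal subgraphs with components in a family\<close>

text \<open>A vertex covered by a matching lies on exactly one of its edges, so a walk cannot leave
  that edge. This turns every nonempty matching into a subgraph with components in the
  family.\<close>

lemma matching_graph_component:
  assumes M: "pairwise disjnt M" "\<And>e. e \<in> M \<Longrightarrow> card e = 2"
    and C: "C \<in> connected_components \<lparr>verts = \<Union>M, edges = M\<rparr>"
  shows "graph_iso C (complete_graph 2)"
proof -
  let ?H = "\<lparr>verts = \<Union>M, edges = M\<rparr>"
  obtain v where v: "v \<in> \<Union>M" "C = induced_subgraph ?H {w \<in> \<Union>M. reachable ?H v w}"
    using C by (auto simp: connected_components_def)
  then obtain e where e: "e \<in> M" "v \<in> e" by blast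
  have uniq: "e' = e" if "e' \<in> M" "u \<in> e'" "u \<in> e" for e' u
    using M(1) that e(1) by (auto simp: pairwise_def disjnt_def)
  obtain b where b: "e = {v, b}" "v \<noteq> b" using M(2)[OF e(1)] e(2) by (auto simp: card_2_iff)
  have "w \<in> e" if "reachable ?H v w" for w
    using that unfolding reachable_def
  proof (induction rule: rtranclp_induct)
    case (step u w)
    hence "{u, w} = e" using uniq[of "{u, w}" u] by simp
    thus ?case by blast
  qed (use e in auto)
  moreover have "reachable ?H v v" "reachable ?H v b"
    using e(1) b(1) by (auto simp: reachable_def)
  ultimately have "{w \<in> \<Union>M. reachable ?H v w} = e" using e b(1) by auto
  hence "C = \<lparr>verts = e, edges = {e' \<in> M. e' \<subseteq> e}\<rparr>"
    using v(2) by (simp add: induced_subgraph_def)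
  moreover have "{e' \<in> M. e' \<subseteq> e} = {e}"
  proof -
    have "e' = e" if "e' \<in> M" "e' \<subseteq> e" for e'
    proof -
      have "e' \<noteq> {}" using M(2)[OF that(1)] by auto
      thus ?thesis using uniq[OF that(1)] that(2) by blast
    qed
    thus ?thesis using e(1) by blast
  qed
  ultimately have C': "C = \<lparr>verts = {v, b}, edges = {{v, b}}\<rparr>" by (simp add: b)
  have edges2: "{e. e \<subseteq> {..<2} \<and> card e = 2} = {{0, 1 :: nat}}"
  proof -
    have "e = {0, 1}" if "e \<subseteq> {..<2}" "card e = 2" for e :: "nat set"
      using card_subset_eq[OF _ that(1)] that(2) by auto
    thus ?thesis by auto
  qed
  show ?thesis
    unfolding graph_iso_def C' complete_graph_def edges2
    using b(2) by (intro exI[of _ "\<lambda>u. if u = v then 0 else 1"]) (auto simp: bij_betw_def inj_on_def)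
qed

lemma matching_graph_family_subgraph:
  assumes G: "simple_graph G" and M: "M \<subseteq> edges G" "pairwise disjnt M" "M \<noteq> {}"
    and H: "complete_graph 2 \<in> \<H>"
  shows "family_subgraph \<H> \<lparr>verts = \<Union>M, edges = M\<rparr> G"
proof -
  have e: "e \<subseteq> verts G \<and> card e = 2" if "e \<in> M" for e
    using G M(1) that by (auto simp: simple_graph_def)
  have "\<Union>M \<subseteq> verts G" using e by blast
  moreover have "finite (\<Union>M)" using calculation G finite_subset by (auto simp: simple_graph_def)
  moreover have "\<Union>M \<noteq> {}" using M(3) e by fastforce
  moreover have "\<exists>D\<in>\<H>. graph_iso C D"
    if "C \<in> connected_components \<lparr>verts = \<Union>M, edges = M\<rparr>" for C
    using matching_graph_component[OF M(2) _ that] e H by blast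
  ultimately show ?thesis
    unfolding family_subgraph_def subgraph_def simple_graph_def using e M(1) by auto
qed

lemma simple_graph_delete_verts: "simple_graph G \<Longrightarrow> simple_graph (delete_verts G W)"
  by (auto simp: simple_graph_def delete_verts_def induced_subgraph_def)

text \<open>An edge left over would by itself be a further subgraph with components in the
  family.\<close>

lemma maximal_family_subgraph_independent:
  assumes G: "simple_graph G" and \<H>: "complete_graph 2 \<in> \<H>" and H: "maximal_family_subgraph \<H> H G"
    and e: "e \<in> edges G"
  shows "\<not> e \<subseteq> verts G - verts H"
proof
  assume "e \<subseteq> verts G - verts H"
  hence "{e} \<subseteq> edges (delete_verts G (verts H))"
    using e by (simp add: delete_verts_def induced_subgraph_def)
  from matching_graph_family_subgraph[OF simple_graph_delete_verts[OF G] this _ _ \<H>]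
  show False using H unfolding maximal_family_subgraph_def by auto
qed

text \<open>Makes the minimum in \<open>min_match\<close> run over a nonempty set. A maximum
  matching works: every member of the family has an edge, so a further subgraph would supply an edge
  disjoint from the matching.\<close>

lemma ex_maximal_family_subgraph:
  assumes G: "simple_graph G" and ne: "edges G \<noteq> {}"
    and \<H>: "\<H> \<subseteq> {cycle_graph k |k. k \<ge> 3} \<union> {complete_graph 2}" "complete_graph 2 \<in> \<H>"
  shows "\<exists>H. maximal_family_subgraph \<H> H G"
proof -
  have fin: "finite (edges G)" by (rule simple_graph_finite_edges[OF G])
  obtain e0 where e0: "e0 \<in> edges G" using ne by blast
  have "\<exists>M. matching G M \<and> (\<forall>N. matching G N \<longrightarrow> card N \<le> card M)"
  proof (rule ex_has_greatest_nat)
    show "matching G {e0}" using e0 by (simp add: matching_def)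
    show "\<forall>N. matching G N \<longrightarrow> card N < Suc (card (edges G))"
      using fin by (auto simp: matching_def less_Suc_eq_le intro: card_mono)
  qed
  then obtain M where M: "matching G M" "\<And>N. matching G N \<Longrightarrow> card N \<le> card M" by blast
  have finM: "finite M" using M(1) fin finite_subset by (auto simp: matching_def)
  have "card {e0} \<le> card M" using e0 by (intro M(2)) (simp add: matching_def)
  hence "M \<noteq> {}" by auto
  hence fam: "family_subgraph \<H> \<lparr>verts = \<Union>M, edges = M\<rparr> G"
    using matching_graph_family_subgraph[OF G _ _ _ \<H>(2)] M(1) by (simp add: matching_def)
  have "\<not> family_subgraph \<H> H' (delete_verts G (\<Union>M))" for H'
  proof
    assume H': "family_subgraph \<H> H' (delete_verts G (\<Union>M))"
    then obtain v where v: "v \<in> verts H'" by (auto simp: family_subgraph_def)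
    then obtain C where C: "C \<in> connected_components H'" by (auto simp: connected_components_def)
    then obtain D where D: "D \<in> \<H>" "graph_iso C D" using H' by (auto simp: family_subgraph_def)
    have "\<exists>e. e \<in> edges D"
    proof -
      have "{0, 1} \<in> edges (complete_graph 2)" by (auto simp: complete_graph_def)
      moreover have "{0, Suc 0 mod k} \<in> edges (cycle_graph k)" if "k \<ge> 3" for k
        using that unfolding cycle_graph_def by (auto intro!: exI[of _ 0])
      ultimately show ?thesis using D(1) \<H>(1) by blast
    qed
    then obtain e where e: "e \<in> edges C" using D(2) by (force simp: graph_iso_def)
    have "e \<in> edges (delete_verts G (\<Union>M))"
      using component_edges[OF C e] H' by (auto simp: family_subgraph_def subgraph_def)
    hence eG: "e \<in> edges G" "e \<inter> \<Union>M = {}" by (auto simp: delete_verts_def induced_subgraph_def)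
    have "e \<noteq> {}" using G eG(1) by (auto simp: simple_graph_def)
    hence "e \<notin> M" using eG(2) by blast
    moreover have "matching G (insert e M)"
      using M(1) eG unfolding matching_def pairwise_insert disjnt_def by blast
    ultimately show False using M(2)[of "insert e M"] finM by simp
  qed
  thus ?thesis
    using fam unfolding maximal_family_subgraph_def by (intro exI[of _ "\<lparr>verts = \<Union>M, edges = M\<rparr>"]) auto
qed

lemma min_match_attained:
  assumes G: "simple_graph G" and ne: "edges G \<noteq> {}"
    and \<H>: "\<H> \<subseteq> {cycle_graph k |k. k \<ge> 3} \<union> {complete_graph 2}" "complete_graph 2 \<in> \<H>"
  shows "\<exists>H. maximal_family_subgraph \<H> H G \<and> min_match \<H> G = matching_number H"
proof -
  have "finite (edges G)" "finite (verts G)"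
    using simple_graph_finite_edges[OF G] G by (simp_all add: simple_graph_def)
  hence "finite ((\<lambda>(A, B). \<lparr>verts = A, edges = B\<rparr>) ` (Pow (verts G) \<times> Pow (edges G)))" by blast
  moreover have "{H. maximal_family_subgraph \<H> H G} \<subseteq>
      (\<lambda>(A, B). \<lparr>verts = A, edges = B\<rparr>) ` (Pow (verts G) \<times> Pow (edges G))"
  proof
    fix H assume "H \<in> {H. maximal_family_subgraph \<H> H G}"
    hence "(verts H, edges H) \<in> Pow (verts G) \<times> Pow (edges G)"
      by (auto simp: maximal_family_subgraph_def family_subgraph_def subgraph_def)
    thus "H \<in> (\<lambda>(A, B). \<lparr>verts = A, edges = B\<rparr>) ` (Pow (verts G) \<times> Pow (edges G))"
      by (intro image_eqI[of _ _ "(verts H, edges H)"]) simp_all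
  qed
  ultimately have "finite {H. maximal_family_subgraph \<H> H G}" by (rule rev_finite_subset)
  hence "finite {matching_number H |H. maximal_family_subgraph \<H> H G}" by simp
  moreover have "{matching_number H |H. maximal_family_subgraph \<H> H G} \<noteq> {}"
    using ex_maximal_family_subgraph[OF assms] by blast
  ultimately have "Min {matching_number H |H. maximal_family_subgraph \<H> H G} \<in>
      {matching_number H |H. maximal_family_subgraph \<H> H G}"
    by (rule Min_in)
  thus ?thesis using ne by (auto simp: min_match_def)
qed

theorem reg_le_min_match:
  fixes P :: "(('v, 'k::field) mpoly, 'm) free_res"
  assumes G: "simple_graph G" and P: "resolves_field (verts G) P"
    and \<H>: "\<H> \<subseteq> {cycle_graph k |k. k \<ge> 3} \<union> {complete_graph 2}" "complete_graph 2 \<in> \<H>"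
  shows "reg_le (verts G) P (edges G) (verts G) (min_match \<H> G)"
proof -
  have V: "finite (verts G)" and E: "\<And>e. e \<in> edges G \<Longrightarrow> e \<subseteq> verts G \<and> card e = 2"
    using G by (auto simp: simple_graph_def)
  show ?thesis
  proof (cases "edges G = {}")
    case True
    have "reg_le (verts G) P (edges G) (verts G) 0"
      by (rule reg_le_independent[OF V P E]) (auto simp: True)
    thus ?thesis using True by (simp add: min_match_def)
  next
    case False
    obtain H where H: "maximal_family_subgraph \<H> H G" "min_match \<H> G = matching_number H"
      using min_match_attained[OF G False \<H>] by blast
    have fam: "family_subgraph \<H> H G" using H(1) by (simp add: maximal_family_subgraph_def)
    have r: "reg_le (verts G) P (edges G) (verts G - verts H) 0"
      using maximal_family_subgraph_independent[OF G \<H>(2) H(1)]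
      by (intro reg_le_independent[OF V P E]) auto
    have "reg_le (verts G) P (edges G) (verts G) (0 + matching_number H)"
    proof (rule reg_le_family_subgraph[OF V P E _ _ _ r])
      show "\<forall>C\<in>connected_components H. \<exists>D. (D = complete_graph 2 \<or> (\<exists>k\<ge>3. D = cycle_graph k)) \<and> graph_iso C D"
      proof
        fix C assume "C \<in> connected_components H"
        then obtain D where "D \<in> \<H>" "graph_iso C D" using fam by (auto simp: family_subgraph_def)
        thus "\<exists>D. (D = complete_graph 2 \<or> (\<exists>k\<ge>3. D = cycle_graph k)) \<and> graph_iso C D"
          using \<H>(1) by blast
      qed
    qed (use fam in \<open>auto simp: family_subgraph_def subgraph_def\<close>)
    thus ?thesis using H(2) by simp
  qed
qed


section \<open>The quotient module of a polynomial ring\<close>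

lemma mpoly_ring_simps [simp]:
  "p \<otimes>\<^bsub>mpoly_ring V\<^esub> q = p * q" "p \<oplus>\<^bsub>mpoly_ring V\<^esub> q = p + q"
  "\<zero>\<^bsub>mpoly_ring V\<^esub> = 0" "\<one>\<^bsub>mpoly_ring V\<^esub> = 1"
  by (simp_all add: mpoly_ring_def)

lemma cring_mpoly_ring: "cring (mpoly_ring V :: ('v, 'k::field) mpoly ring)"
proof (rule cringI)
  show "abelian_group (mpoly_ring V :: ('v, 'k) mpoly ring)"
  proof (rule abelian_groupI)
    fix p :: "('v, 'k) mpoly" assume "p \<in> carrier (mpoly_ring V)"
    thus "\<exists>q\<in>carrier (mpoly_ring V). q \<oplus>\<^bsub>mpoly_ring V\<^esub> p = \<zero>\<^bsub>mpoly_ring V\<^esub>"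
      by (intro bexI[of _ "- p"]) (auto intro: polys_uminus)
  qed (auto simp: algebra_simps)
  show "comm_monoid (mpoly_ring V :: ('v, 'k) mpoly ring)"
    by (rule comm_monoidI) (auto simp: mult_ac)
qed (simp add: distrib_right)

lemma ring_mpoly_ring: "ring (mpoly_ring V :: ('v, 'k::field) mpoly ring)"
  using cring_mpoly_ring by (rule cring.axioms)

lemma a_inv_mpoly_ring:
  fixes p :: "('v, 'k::field) mpoly"
  assumes "p \<in> polys V"
  shows "\<ominus>\<^bsub>mpoly_ring V\<^esub> p = - p"
proof -
  interpret ring "mpoly_ring V :: ('v, 'k) mpoly ring" by (rule ring_mpoly_ring)
  show ?thesis using assms by (intro minus_equality) (auto intro: polys_uminus)
qed

lemma ideal_mpoly_ringI:
  fixes I :: "('v, 'k::field) mpoly set"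
  assumes I: "poly_ideal V I"
  shows "ideal I (mpoly_ring V)"
proof (rule idealI[OF ring_mpoly_ring])
  interpret ring "mpoly_ring V :: ('v, 'k) mpoly ring" by (rule ring_mpoly_ring)
  show "subgroup I (add_monoid (mpoly_ring V))"
  proof
    show "inv\<^bsub>add_monoid (mpoly_ring V)\<^esub> p \<in> I" if "p \<in> I" for p
      using that a_inv_mpoly_ring[OF ideal_polys[OF I that]] ideal_uminus[OF I that]
      by (simp add: a_inv_def)
  qed (use ideal_polys[OF I] ideal_0[OF I] ideal_add[OF I] in auto)
  fix a x :: "('v, 'k) mpoly" assume "a \<in> I" "x \<in> carrier (mpoly_ring V)"
  hence "x * a \<in> I" using ideal_mult[OF I] by simp
  thus "x \<otimes>\<^bsub>mpoly_ring V\<^esub> a \<in> I" "a \<otimes>\<^bsub>mpoly_ring V\<^esub> x \<in> I" by (simp_all add: mult.commute)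
qed

lemma ideal_mpoly_ringD:
  fixes I :: "('v, 'k::field) mpoly set"
  assumes "ideal I (mpoly_ring V)"
  shows "poly_ideal V I"
proof -
  interpret ideal I "mpoly_ring V" by fact
  show ?thesis
    unfolding poly_ideal_def
    using a_subset additive_subgroup.zero_closed[OF is_additive_subgroup]
      additive_subgroup.a_closed[OF is_additive_subgroup] I_l_closed by auto
qed

context
  fixes V and I :: "('v, 'k::field) mpoly set"
  assumes I: "poly_ideal V I"
begin

interpretation ideal I "mpoly_ring V" by (rule ideal_mpoly_ringI[OF I])

lemma coset_eq_iff:
  assumes "p \<in> polys V" "q \<in> polys V"
  shows "I +>\<^bsub>mpoly_ring V\<^esub> p = I +>\<^bsub>mpoly_ring V\<^esub> q \<longleftrightarrow> p - q \<in> I"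
  using quotient_eq_iff_same_a_r_cos[OF is_ideal, of p q] assms
  by (simp add: a_minus_def a_inv_mpoly_ring)

lemma carrier_quotient_module: "carrier (quotient_module (mpoly_ring V) I) = (\<lambda>p. I +>\<^bsub>mpoly_ring V\<^esub> p) ` polys V"
  by (auto simp: quotient_module_def ring.defs module.defs FactRing_def A_RCOSETS_def')

lemma zero_quotient_module: "\<zero>\<^bsub>quotient_module (mpoly_ring V) I\<^esub> = I +>\<^bsub>mpoly_ring V\<^esub> 0"
  using a_coset_add_zero[OF a_subset]
  by (simp add: quotient_module_def ring.defs module.defs FactRing_def)

lemma add_quotient_module:
  "p \<in> polys V \<Longrightarrow> q \<in> polys V \<Longrightarrow> (I +>\<^bsub>mpoly_ring V\<^esub> p) \<oplus>\<^bsub>quotient_module (mpoly_ring V) I\<^esub> (I +>\<^bsub>mpoly_ring V\<^esub> q) = I +>\<^bsub>mpoly_ring V\<^esub> (p + q)"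
  using a_rcos_sum[of p q] by (simp add: quotient_module_def ring.defs module.defs FactRing_def)

lemma smult_quotient_module:
  "a \<in> polys V \<Longrightarrow> p \<in> polys V \<Longrightarrow> a \<odot>\<^bsub>quotient_module (mpoly_ring V) I\<^esub> (I +>\<^bsub>mpoly_ring V\<^esub> p) = I +>\<^bsub>mpoly_ring V\<^esub> (a * p)"
  using rcoset_mult_add[of a p] by (simp add: quotient_module_def ring.defs module.defs FactRing_def)

lemma abelian_monoid_quotient_module: "abelian_monoid (quotient_module (mpoly_ring V) I)"
proof -
  show ?thesis
    by (rule abelian_monoidI)
       (auto simp: carrier_quotient_module zero_quotient_module add_quotient_module polys_add add_ac)
qed

lemma finsum_quotient_module:
  assumes "finite A" "\<And>x. x \<in> A \<Longrightarrow> f x \<in> polys V"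
  shows "(\<Oplus>\<^bsub>quotient_module (mpoly_ring V) I\<^esub>x\<in>A. I +>\<^bsub>mpoly_ring V\<^esub> f x) = I +>\<^bsub>mpoly_ring V\<^esub> (\<Sum>x\<in>A. f x)"
proof -
  interpret M: abelian_monoid "quotient_module (mpoly_ring V) I" by (rule abelian_monoid_quotient_module)
  show ?thesis
    using assms
  proof (induction A rule: finite_induct)
    case (insert x A)
    have "(\<Oplus>\<^bsub>quotient_module (mpoly_ring V) I\<^esub>y\<in>insert x A. I +>\<^bsub>mpoly_ring V\<^esub> f y) = (I +>\<^bsub>mpoly_ring V\<^esub> f x) \<oplus>\<^bsub>quotient_module (mpoly_ring V) I\<^esub> (\<Oplus>\<^bsub>quotient_module (mpoly_ring V) I\<^esub>y\<in>A. I +>\<^bsub>mpoly_ring V\<^esub> f y)"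
      using insert by (intro M.finsum_insert) (auto simp: carrier_quotient_module)
    thus ?case using insert by (simp add: add_quotient_module polys_sum)
  qed (simp add: zero_quotient_module)
qed

lemma aug_map_eq:
  assumes "\<And>k. k < rank F 0 \<Longrightarrow> aug F k = I +>\<^bsub>mpoly_ring V\<^esub> p k" "\<And>k. k < rank F 0 \<Longrightarrow> p k \<in> polys V"
    and v: "v \<in> vecs V (rank F 0)"
  shows "aug_map (quotient_module (mpoly_ring V) I) F v = I +>\<^bsub>mpoly_ring V\<^esub> (\<Sum>k<rank F 0. v k * p k)"
proof -
  interpret M: abelian_monoid "quotient_module (mpoly_ring V) I" by (rule abelian_monoid_quotient_module)
  have "aug_map (quotient_module (mpoly_ring V) I) F v = (\<Oplus>\<^bsub>quotient_module (mpoly_ring V) I\<^esub>k\<in>{..<rank F 0}. I +>\<^bsub>mpoly_ring V\<^esub> (v k * p k))"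
    unfolding aug_map_def
  proof (rule M.finsum_cong'[OF refl])
    show "v k \<odot>\<^bsub>quotient_module (mpoly_ring V) I\<^esub> aug F k = I +>\<^bsub>mpoly_ring V\<^esub> (v k * p k)" if "k \<in> {..<rank F 0}" for k
      using that assms by (simp add: smult_quotient_module vecs_polys[OF v])
  qed (use assms(2) vecs_polys[OF v] in \<open>auto simp: carrier_quotient_module\<close>)
  also have "\<dots> = I +>\<^bsub>mpoly_ring V\<^esub> (\<Sum>k<rank F 0. v k * p k)"
    using assms(2) vecs_polys[OF v] by (intro finsum_quotient_module) auto
  finally show ?thesis .
qed

lemma coset_zero_iff: "p \<in> polys V \<Longrightarrow> I +>\<^bsub>mpoly_ring V\<^esub> p = \<zero>\<^bsub>quotient_module (mpoly_ring V) I\<^esub> \<longleftrightarrow> p \<in> I"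
  using coset_eq_iff[of p 0] by (simp add: zero_quotient_module)

end


section \<open>Bounding the regularity\<close>

lemma vhcomp_apply: "vhcomp s d v k = hcomp (d - s k) (v k)"
  by (simp add: vhcomp_def)

text \<open>Ensures that \<open>SOME\<close> in \<open>graded_betti\<close> picks a resolution. The
  first free module is S with generator mapped to the class of 1; \<open>proper\<close> places
  \<open>I\<close> inside the maximal ideal, so that the first differential is minimal.\<close>

lemma minimal_resolution_quotient:
  fixes I :: "('v, 'k::field) mpoly set"
  assumes V: "finite V" and I: "poly_ideal V I"
    and graded: "\<And>p d. p \<in> I \<Longrightarrow> hcomp d p \<in> I" and proper: "\<And>p. p \<in> I \<Longrightarrow> lookup p 0 = 0"
  shows "\<exists>F. minimal_graded_free_resolution V (quotient_module (mpoly_ring V) I) (quotient_grading V I) F"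
proof -
  let ?N = "{v \<in> vecs V 1. v 0 \<in> I}"
  have "graded_submodule V 1 (\<lambda>_. 0) ?N"
    unfolding graded_submodule_def submodule_of_vecs_def
    using ideal_0[OF I] ideal_add[OF I] ideal_mult[OF I] graded
    by (auto simp: vhcomp_apply simp del: One_nat_def)
  moreover have "lookup (u k) 0 = 0" if "u \<in> ?N" for u k
    using that proper by (cases "k = 0") (auto simp: vecs_def)
  ultimately obtain F :: "(('v, 'k) mpoly, ('v, 'k) mpoly set) free_res"
    where F: "rank F 0 = 1" "shift F 0 = (\<lambda>_. 0)" "aug F = (\<lambda>_. I +>\<^bsub>mpoly_ring V\<^esub> 1)"
      "resolves V F ?N" "minimal_diffs F"
    using ex_minimal_resolution[OF V, where a = "\<lambda>_. I +>\<^bsub>mpoly_ring V\<^esub> 1"] by blast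
  let ?M = "quotient_module (mpoly_ring V) I"
  have aug: "aug_map ?M F v = I +>\<^bsub>mpoly_ring V\<^esub> (v 0)" if "v \<in> vecs V 1" for v
    using aug_map_eq[OF I, of F "\<lambda>_. 1" v] that F by simp
  have "aug F k \<in> quotient_grading V I (shift F 0 k)" for k
    unfolding quotient_grading_def F by (auto intro!: exI[of _ 1])
  moreover have "aug_map ?M F ` vecs V 1 = carrier ?M"
  proof -
    have "aug_map ?M F ` vecs V 1 = (\<lambda>p. I +>\<^bsub>mpoly_ring V\<^esub> p) ` ((\<lambda>v. v 0) ` vecs V 1)"
      unfolding image_image by (intro image_cong refl aug)
    also have "(\<lambda>v. v 0) ` vecs V 1 = (polys V :: ('v, 'k) mpoly set)"
    proof (intro equalityI subsetI)
      fix p :: "('v, 'k) mpoly" assume "p \<in> polys V"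
      thus "p \<in> (\<lambda>v. v 0) ` vecs V 1"
        by (intro image_eqI[of _ _ "\<lambda>k. if k = 0 then p else 0"]) (auto simp: vecs_def)
    qed (auto simp: vecs_def)
    finally show ?thesis using carrier_quotient_module[OF I] by simp
  qed
  moreover have "{v \<in> vecs V 1. aug_map ?M F v = \<zero>\<^bsub>?M\<^esub>} = ?N"
    by (intro Collect_cong conj_cong refl) (simp add: aug coset_zero_iff[OF I] vecs_polys)
  ultimately have "graded_free_resolution V ?M (quotient_grading V I) F"
    using F(1,4) unfolding graded_free_resolution_def free_carrier_eq resolves_def carrier_mpoly_ring
    by auto
  thus ?thesis
    using F(5) unfolding minimal_graded_free_resolution_def minimal_diffs_def by blast
qed

text \<open>Every row of a differential of \<open>F\<close> has a nonzero entry, and by minimality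
  such an entry has positive degree.\<close>

lemma minimal_resolution_shift_lower:
  fixes F :: "(('v, 'k::field) mpoly, 'm) free_res"
  assumes F: "resolves V F N" "minimal_diffs F" and c: "\<And>k. k < rank F 0 \<Longrightarrow> c \<le> shift F 0 k"
    and k: "k < rank F i"
  shows "c + int i \<le> shift F i k"
  using k
proof (induction i arbitrary: k)
  case (Suc i)
  define e where "e = (\<lambda>k'. if k' = k then 1 else 0 :: ('v, 'k) mpoly)"
  have e: "e \<in> vecs V (rank F (Suc i))" using Suc.prems by (auto simp: e_def vecs_def)
  \<comment> \<open>With a zero row the basis vector \<open>e\<close> would be a cycle, hence a
    boundary, but boundaries have no constant terms.\<close>
  have "\<exists>l<rank F i. diff F i k l \<noteq> 0"
  proof (rule ccontr)
    assume "\<not> (\<exists>l<rank F i. diff F i k l \<noteq> 0)"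
    hence "diff_map F i e = (\<lambda>_. 0)"
      using Suc.prems by (auto simp: diff_map_def e_def fun_eq_iff intro!: sum.neutral)
    hence "e \<in> diff_map F (Suc i) ` vecs V (rank F (Suc (Suc i)))"
      using e diff_map_exact[OF F(1), of i] by blast
    then obtain z where "e = diff_map F (Suc i) z" by blast
    hence "lookup (e k) 0 = 0"
      using F(2) by (simp add: diff_map_def lookup_sum lookup_mult_0 minimal_diffs_def)
    thus False by (simp add: e_def)
  qed
  then obtain l where l: "l < rank F i" "diff F i k l \<noteq> 0" by blast
  then obtain m where m: "m \<in> keys (diff F i k l)" by (metis keys_eq_empty ex_in_conv)
  have "lookup (diff F i k l) 0 = 0" using F(2) Suc.prems l(1) by (simp add: minimal_diffs_def)
  hence "monom_degree m \<noteq> 0" using m by (auto simp: monom_degree_eq_0 in_keys_iff)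
  moreover have "int (monom_degree m) = shift F (Suc i) k - shift F i l"
    using diff_homogeneous[OF F(1) Suc.prems l(1)] m by (simp add: homogeneous_def)
  ultimately show ?case using Suc.IH[OF l(1)] by linarith
qed (use c in simp)

theorem reg_quotient_le:
  fixes I :: "('v, 'k::field) mpoly set" and P :: "(('v, 'k) mpoly, 'n) free_res"
  assumes V: "finite V" and P: "resolves_field V P" and I: "poly_ideal V I"
    and graded: "\<And>p d. p \<in> I \<Longrightarrow> hcomp d p \<in> I" and proper: "\<And>p. p \<in> I \<Longrightarrow> lookup p 0 = 0"
    and tor: "\<And>i j. int i + r < j \<Longrightarrow> tor_vanishes V P I i j"
  shows "reg_quotient V I \<le> r"
proof -
  let ?M = "quotient_module (mpoly_ring V) I" and ?Mg = "quotient_grading V I"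
  define F where "F = (SOME F. minimal_graded_free_resolution V ?M ?Mg F)"
  have "minimal_graded_free_resolution V ?M ?Mg F"
    unfolding F_def using minimal_resolution_quotient[OF V I graded proper] by (rule someI_ex)
  hence res: "graded_free_resolution V ?M ?Mg F" and F2: "minimal_diffs F"
    by (auto simp: minimal_graded_free_resolution_def minimal_diffs_def)
  \<comment> \<open>Lifting the augmentation to homogeneous polynomials describes its kernel by a
    condition inside S.\<close>
  have "\<forall>k. \<exists>p. k < rank F 0 \<longrightarrow> aug F k = I +>\<^bsub>mpoly_ring V\<^esub> p \<and> p \<in> polys V \<and> homogeneous (shift F 0 k) p"
  proof
    fix k
    have "aug F k \<in> quotient_grading V I (shift F 0 k)" if "k < rank F 0"
      using res that by (simp add: graded_free_resolution_def)
    thus "\<exists>p. k < rank F 0 \<longrightarrow> aug F k = I +>\<^bsub>mpoly_ring V\<^esub> p \<and> p \<in> polys V \<and>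
        homogeneous (shift F 0 k) p"
      by (cases "k < rank F 0") (auto simp: quotient_grading_def)
  qed
  from choice[OF this] obtain p where p: "\<And>k. k < rank F 0 \<Longrightarrow> aug F k = I +>\<^bsub>mpoly_ring V\<^esub> p k"
    "\<And>k. k < rank F 0 \<Longrightarrow> p k \<in> polys V" "\<And>k. k < rank F 0 \<Longrightarrow> homogeneous (shift F 0 k) (p k)"
    by blast
  let ?N = "{v \<in> vecs V (rank F 0). (\<Sum>k<rank F 0. v k * p k) \<in> I}"
  have sp: "(\<Sum>k<rank F 0. v k * p k) \<in> polys V" if "v \<in> vecs V (rank F 0)" for v
    using p(2) vecs_polys[OF that] by auto
  have aug: "aug_map ?M F v = I +>\<^bsub>mpoly_ring V\<^esub> (\<Sum>k<rank F 0. v k * p k)" if "v \<in> vecs V (rank F 0)" for v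
    using aug_map_eq[OF I p(1,2) that] .
  have "{v \<in> vecs V (rank F 0). aug_map ?M F v = \<zero>\<^bsub>?M\<^esub>} = ?N"
    by (intro Collect_cong conj_cong refl) (simp add: aug coset_zero_iff[OF I] sp)
  hence F1: "resolves V F ?N"
    using res unfolding graded_free_resolution_def resolves_def free_carrier_eq carrier_mpoly_ring
    by auto
  have "I +>\<^bsub>mpoly_ring V\<^esub> 1 \<in> aug_map ?M F ` vecs V (rank F 0)"
    using res unfolding graded_free_resolution_def free_carrier_eq
    by (simp add: carrier_quotient_module[OF I])
  then obtain w where w: "w \<in> vecs V (rank F 0)"
    "I +>\<^bsub>mpoly_ring V\<^esub> 1 = I +>\<^bsub>mpoly_ring V\<^esub> (\<Sum>k<rank F 0. w k * p k)"
    using aug by auto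
  hence w1: "1 - (\<Sum>k<rank F 0. w k * p k) \<in> I"
    using coset_eq_iff[OF I polys_1 sp[OF w(1)]] by simp
  have upper: "shift F i k - int i \<le> r" if "k < rank F i" for i k
  proof (rule ccontr)
    assume "\<not> shift F i k - int i \<le> r"
    hence "tor_vanishes V P I i (shift F i k)" by (intro tor) simp
    moreover have "resolves V P (maximal_vecs V)" using P by (simp add: resolves_field_def)
    ultimately have "tor_vanishes_mod V P (rank F 0) (shift F 0) ?N i (shift F i k)"
      using tor_vanishes_presentation[OF _ I p(2,3) w(1) w1] by blast
    thus False using minimal_resolution_shift[OF P F1 F2 _ that] by blast
  qed
  \<comment> \<open>The ideal is proper, so the quotient is nonzero and the maximum is over a
    nonempty set.\<close>
  have pos: "rank F 0 > 0"
  proof (rule ccontr)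
    assume "\<not> rank F 0 > 0"
    hence "1 \<in> I" using w1 by simp
    thus False using proper[of 1] by simp
  qed
  define c where "c = Min (shift F 0 ` {..<rank F 0})"
  have "c \<le> shift F 0 k" if "k < rank F 0" for k unfolding c_def using that by simp
  hence lower: "c \<le> shift F i k - int i" if "k < rank F i" for i k
    using minimal_resolution_shift_lower[OF F1 F2 _ that, of c] by fastforce
  have betti: "graded_betti V ?M ?Mg i j \<noteq> 0 \<longleftrightarrow> (\<exists>k<rank F i. shift F i k = j)" for i j
    by (auto simp: graded_betti_def F_def[symmetric] Let_def card_eq_0_iff)
  let ?S = "{j - int i |i j. graded_betti V ?M ?Mg i j \<noteq> 0}"
  have S: "?S = {shift F i k - int i |i k. k < rank F i}" unfolding betti by blast
  have "finite ?S"
    unfolding S by (rule finite_subset[of _ "{c..r}"]) (use lower upper in auto)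
  moreover have "?S \<noteq> {}" unfolding S using pos by blast
  ultimately show ?thesis
    unfolding reg_quotient_def regularity_def
  proof (rule Max.boundedI)
    show "d \<le> r" if "d \<in> ?S" for d using that upper unfolding S by blast
  qed
qed

section \<open>Edge ideals as monomial ideals\<close>

lemma edge_ideal_eq:
  assumes "simple_graph G"
  shows "edge_ideal G = (monomial_ideal (verts G) (graph_monom (edges G) (verts G) {}) :: ('v, 'k::field) mpoly set)"
    (is "_ = ?J")
proof -
  let ?V = "verts G"
  let ?gens = "{var u * var v |u v. {u, v} \<in> edges G} :: ('v, 'k) mpoly set"
  have E: "u \<in> ?V \<and> v \<in> ?V" if "{u, v} \<in> edges G" for u v
    using assms that unfolding simple_graph_def by blast
  have var2: "var u * var v = (single (single u 1 + single v 1) 1 :: ('v, 'k) mpoly)" for u v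
    by (simp add: var_def mult_single)
  have gens: "?gens \<subseteq> polys ?V" using E by (auto intro!: polys_mult var_in_polys)
  interpret ring "mpoly_ring ?V :: ('v, 'k) mpoly ring" by (rule ring_mpoly_ring)
  have J: "poly_ideal ?V ?J" by (rule monomial_ideal_ideal[OF up_closed_graph_monom])
  have gensJ: "?gens \<subseteq> ?J"
  proof
    fix q :: "('v, 'k) mpoly" assume q: "q \<in> ?gens"
    then obtain u v where uv: "q = var u * var v" "{u, v} \<in> edges G" by blast
    have "graph_monom (edges G) ?V {} (single u 1 + single v 1)"
      unfolding graph_monom_def using uv(2) E[OF uv(2)]
      by (intro disjI2 exI[of _ u] exI[of _ v]) (simp add: lookup_add)
    thus "q \<in> ?J" using q gens by (auto simp: monomial_ideal_def uv(1) var2)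
  qed
  have "edge_ideal G \<subseteq> ?J"
    unfolding edge_ideal_def using gensJ by (intro genideal_minimal ideal_mpoly_ringI J)
  moreover have "?J \<subseteq> edge_ideal G"
  proof
    fix p :: "('v, 'k) mpoly" assume p: "p \<in> ?J"
    have I: "poly_ideal ?V (edge_ideal G :: ('v, 'k) mpoly set)"
      unfolding edge_ideal_def using gens by (intro ideal_mpoly_ringD genideal_ideal) simp
    have "single m (lookup p m) \<in> (edge_ideal G :: ('v, 'k) mpoly set)" if m: "m \<in> keys p" for m
    proof -
      obtain a b where ab: "{a, b} \<in> edges G" "0 < lookup m a" "0 < lookup m b"
        using p m by (auto simp: monomial_ideal_def graph_monom_def)
      \<comment> \<open>For the product of the two variables to divide \<open>m\<close>, the
        positive exponents must belong to distinct variables.\<close>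
      have "a \<noteq> b" using assms ab(1) unfolding simple_graph_def by fastforce
      define m' where "m' = m - (single a 1 + single b 1)"
      have m': "m = m' + (single a 1 + single b 1)"
        using ab \<open>a \<noteq> b\<close> unfolding m'_def
        by (intro poly_mapping_eqI) (auto simp: lookup_add lookup_minus lookup_single when_def)
      have "keys m \<subseteq> ?V" using p m by (auto simp: monomial_ideal_def polys_def)
      hence "single m' (lookup p m) \<in> polys ?V"
        by (intro polys_single) (subst (asm) m', simp add: keys_add_nat)
      moreover have "var a * var b \<in> (edge_ideal G :: ('v, 'k) mpoly set)"
        unfolding edge_ideal_def using gens ab(1) genideal_self[of ?gens] by auto
      ultimately have "single m' (lookup p m) * (var a * var b) \<in> (edge_ideal G :: ('v, 'k) mpoly set)"
        by (rule ideal_mult[OF I])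
      moreover have "single m' (lookup p m) * (var a * var b) = single m (lookup p m)"
        unfolding var2 mult_single m'[symmetric] by simp
      ultimately show ?thesis by simp
    qed
    hence "(\<Sum>m\<in>keys p. single m (lookup p m)) \<in> (edge_ideal G :: ('v, 'k) mpoly set)"
      by (intro ideal_sum[OF I])
    moreover have "(\<Sum>m\<in>keys p. single m (lookup p m)) = p"
      by (rule poly_mapping_eqI) (simp add: lookup_sum lookup_single when_def in_keys_iff)
    ultimately show "p \<in> edge_ideal G" by simp
  qed
  ultimately show ?thesis by blast
qed

lemma reg_edge_ideal_le_min_match:
  fixes G :: "'v graph"
  assumes G: "simple_graph G"
    and \<H>: "\<H> \<subseteq> {cycle_graph k |k. k \<ge> 3} \<union> {complete_graph 2}" "complete_graph 2 \<in> \<H>"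
  shows "reg_quotient (verts G) (edge_ideal G :: ('v, 'k::field) mpoly set) \<le> int (min_match \<H> G)"
proof -
  have V: "finite (verts G)" using G by (simp add: simple_graph_def)
  obtain P :: "(('v, 'k) mpoly, unit) free_res" where P: "resolves_field (verts G) P"
    using ex_resolves_field[OF V] by blast
  let ?I = "monomial_ideal (verts G) (graph_monom (edges G) (verts G) {}) :: ('v, 'k) mpoly set"
  have "reg_quotient (verts G) ?I \<le> int (min_match \<H> G)"
  proof (rule reg_quotient_le[OF V P])
    show "poly_ideal (verts G) ?I" by (rule monomial_ideal_ideal[OF up_closed_graph_monom])
    show "hcomp d p \<in> ?I" if "p \<in> ?I" for p d using that by (rule hcomp_monomial_ideal)
    show "lookup p 0 = 0" if "p \<in> ?I" for p
    proof -
      have "\<not> graph_monom (edges G) (verts G) {} 0" by (simp add: graph_monom_def)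
      thus ?thesis using that by (auto simp: monomial_ideal_def in_keys_iff)
    qed
    show "tor_vanishes (verts G) P ?I i j" if "int i + int (min_match \<H> G) < j" for i j
      using reg_le_min_match[OF G P \<H>] that unfolding reg_le_def by blast
  qed
  thus ?thesis by (simp only: edge_ideal_eq[OF G])
qed

theorem theorem3p7:
  fixes G :: "'v graph"
  assumes "simple_graph G"
  shows "(\<forall>\<H>. \<H> \<subseteq> {cycle_graph k |k. k \<ge> 3} \<union> {complete_graph 2} \<and> complete_graph 2 \<in> \<H> \<longrightarrow>
            reg_quotient (verts G) (edge_ideal G :: ('v, 'k::field) mpoly set) \<le> int (min_match \<H> G)) \<and>
         reg_quotient (verts G) (edge_ideal G :: ('v, 'k) mpoly set)
           \<le> int (min_match {complete_graph 2, cycle_graph 5} G)"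
proof (intro conjI allI impI)
  have "cycle_graph 5 \<in> {cycle_graph k |k. k \<ge> 3}" by (intro CollectI exI[of _ 5]) simp
  thus "reg_quotient (verts G) (edge_ideal G :: ('v, 'k) mpoly set)
      \<le> int (min_match {complete_graph 2, cycle_graph 5} G)"
    by (intro reg_edge_ideal_le_min_match[OF assms]) auto
qed (use reg_edge_ideal_le_min_match[OF assms] in blast)

end
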